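(* There exist no finite energy axisymmetric without swirls $C^2$ solutions $\varphi=(\varphi_1,\varphi_2,\varphi_3):\mathbb{R}^3\to\mathbb{S}^2$ of the strongly coupled Faddeev-Skyrme model on $\mathbb{R}^3$ with the potential of the form $P=(1-\varphi_3^a)^b$, $a,b\in\mathbb{R}_+$.
   Context: $\mathbb{R}^3$ carries the Euclidean metric and $\mathbb{S}^2\subset\mathbb{R}^3\cong\mathbb{C}\times\mathbb{R}$ is the unit sphere with its standard metric. The fields of the model are maps $\varphi:\mathbb{R}^3\to\mathbb{S}^2$ satisfying the asymptotic boundary condition $\lim_{|x|\to\infty}\varphi(x)=(0,0,1)$. For such a map, $|\wedge^2\mathrm{d}\varphi|^2=\sum_{i<j}\lambda_i^2\lambda_j^2$, where $\lambda_i^2$ are the eigenvalues of the Cauchy-Green tensor $\mathrm{d}\varphi^t\circ\mathrm{d}\varphi$; equivalently it equals $|\varphi^*\omega|^2$, with $\omega$ the area form of $\mathbb{S}^2$. A potential is a non-negative $C^1$ function $\overline{P}$ on $\mathbb{S}^2$, and one writes $P=\overline{P}\circ\varphi$. The energy of $\varphi$ is $$\frac12\int_{\mathbb{R}^3}\{|\wedge^2\mathrm{d}\varphi|^2+2\,\overline{P}\circ\varphi\}\,\mathrm{d}x .$$ A $C^2$ map $\varphi$ is a solution of the strongly coupled Faddeev-Skyrme model with potential $\overline{P}$ if it is $\sigma_2$-critical with potential $\overline{P}$, that is, for every compact domain $K\subset\mathbb{R}^3$ and every variation $\{\varphi_s\}$ of $\varphi=\varphi_0$ supported in $K$, $$\frac{d}{ds}\Big|_{s=0}\frac12\int_K\{|\wedge^2\mathrm{d}\varphi_s|^2+2\,\overline{P}\circ\varphi_s\}\,\mathrm{d}x=0.$$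 In cylindrical coordinates $(\rho,\theta,z)$ on $\mathbb{R}^3$, $\varphi$ is called axisymmetric (axially symmetric) if it has the form $$\varphi(\rho e^{\mathrm{i}\theta},z)=\big(\sin\Theta(\rho,z)\,e^{\mathrm{i}(\ell\theta-k\psi(\rho,z))},\ \cos\Theta(\rho,z)\big)$$ with $k,\ell\in\mathbb{Z}$ and real functions $\Theta,\psi$ of $(\rho,z)$. It is said to have no swirls if moreover $\psi=A(\Theta)$ for some function $A$ of one variable.
   Formalization: The claim is proved for non-constant solutions φ: the constant map (0,0,1) is itself a finite energy axisymmetric solution without swirls, so the literal statement fails for it; a and b are read as strictly positive. *)

theory Defs
  imports "HOL-Analysis.Analysis"
begin

definition C1_on :: "'a::real_normed_vector set \<Rightarrow> ('a \<Rightarrow> 'b::real_normed_vector) \<Rightarrow> bool" where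
  "C1_on S f \<longleftrightarrow> open S \<and>
     (\<exists>f' :: 'a \<Rightarrow> 'a \<Rightarrow>\<^sub>L 'b.
        (\<forall>x\<in>S. (f has_derivative blinfun_apply (f' x)) (at x)) \<and> continuous_on S f')"

definition C2_on :: "'a::real_normed_vector set \<Rightarrow> ('a \<Rightarrow> 'b::real_normed_vector) \<Rightarrow> bool" where
  "C2_on S f \<longleftrightarrow> open S \<and>
     (\<exists>f' :: 'a \<Rightarrow> 'a \<Rightarrow>\<^sub>L 'b.
        (\<forall>x\<in>S. (f has_derivative blinfun_apply (f' x)) (at x)) \<and> C1_on S f')"

abbreviation S2 :: "(real^3) set" where
  "S2 \<equiv> sphere 0 1"

text \<open>The identification of \<open>\<complex> \<times> \<real>\<close> with \<open>\<real>\<^sup>3\<close>.\<close>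

definition cr :: "complex \<Rightarrow> real \<Rightarrow> real^3" where
  "cr w t = vector [Re w, Im w, t]"

text \<open>A function on the compact submanifold \<open>S2\<close> is \<open>C\<^sup>1\<close> iff it has a \<open>C\<^sup>1\<close> extension to an
  open neighbourhood. The values of \<open>P\<close> off \<open>S2\<close> are irrelevant.\<close>

definition potential :: "(real^3 \<Rightarrow> real) \<Rightarrow> bool" where
  "potential P \<longleftrightarrow> (\<forall>y\<in>S2. 0 \<le> P y) \<and>
     (\<exists>U F. S2 \<subseteq> U \<and> C1_on U F \<and> (\<forall>y\<in>S2. F y = P y))"

text \<open>\<open>P(y) = (1 - y\<^sub>3\<^sup>a)\<^sup>b\<close> at every point of the sphere at which the real power \<open>y\<^sub>3\<^sup>a\<close> is
  defined: \<open>y\<^sub>3 \<ge> 0\<close> for general \<open>a\<close> (note \<open>0 powr a = 0\<close>), and all \<open>y\<^sub>3\<close> if \<open>a\<close> is a natural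
  number. The case split is needed since \<open>powr\<close> has no meaning at a negative base.\<close>

definition power_form :: "real \<Rightarrow> real \<Rightarrow> (real^3 \<Rightarrow> real) \<Rightarrow> bool" where
  "power_form a b P \<longleftrightarrow>
     (\<forall>y\<in>S2. 0 \<le> y$3 \<longrightarrow> P y = (1 - (y$3) powr a) powr b) \<and>
     (\<forall>n::nat. a = real n \<longrightarrow> (\<forall>y\<in>S2. P y = (1 - (y$3) ^ n) powr b))"

text \<open>The eigenvalues of a \<open>3 \<times> 3\<close> matrix, with multiplicity.\<close>

definition eigenvalues3 :: "real^3^3 \<Rightarrow> real \<Rightarrow> real \<Rightarrow> real \<Rightarrow> bool" where
  "eigenvalues3 C m1 m2 m3 \<longleftrightarrow> (\<forall>t. det (mat t - C) = (t - m1) * (t - m2) * (t - m3))"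

definition cauchy_green :: "(real^3 \<Rightarrow> real^3) \<Rightarrow> real^3 \<Rightarrow> real^3^3" where
  "cauchy_green \<phi> x =
     (let J = matrix (frechet_derivative \<phi> (at x)) in transpose J ** J)"

text \<open>The quantity \<open>|\<wedge>\<^sup>2 d\<phi>|\<^sup>2\<close>; existence and uniqueness of the described number are shown below.\<close>

definition wedge2_sq :: "(real^3 \<Rightarrow> real^3) \<Rightarrow> real^3 \<Rightarrow> real" where
  "wedge2_sq \<phi> x =
     (THE e. \<exists>m1 m2 m3. eigenvalues3 (cauchy_green \<phi> x) m1 m2 m3 \<and>
        e = m1 * m2 + m1 * m3 + m2 * m3)"

definition energy_density :: "(real^3 \<Rightarrow> real) \<Rightarrow> (real^3 \<Rightarrow> real^3) \<Rightarrow> real^3 \<Rightarrow> real" where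
  "energy_density P \<phi> x = wedge2_sq \<phi> x + 2 * P (\<phi> x)"

definition energy :: "(real^3 \<Rightarrow> real) \<Rightarrow> (real^3 \<Rightarrow> real^3) \<Rightarrow> ennreal" where
  "energy P \<phi> = (\<integral>\<^sup>+x. ennreal (1/2 * energy_density P \<phi> x) \<partial>lborel)"

definition compact_domain :: "(real^3) set \<Rightarrow> bool" where
  "compact_domain K \<longleftrightarrow> compact K \<and>
     (\<exists>U. open U \<and> connected U \<and> U \<noteq> {} \<and> K = closure U)"

definition variation ::
  "(real^3 \<Rightarrow> real^3) \<Rightarrow> (real^3) set \<Rightarrow> real \<Rightarrow> (real \<Rightarrow> real^3 \<Rightarrow> real^3) \<Rightarrow> bool" where
  "variation \<phi> K \<epsilon> \<Phi> \<longleftrightarrow> 0 < \<epsilon> \<and>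
     C2_on ({-\<epsilon><..<\<epsilon>} \<times> UNIV) (\<lambda>(s, x). \<Phi> s x) \<and>
     (\<forall>s\<in>{-\<epsilon><..<\<epsilon>}. \<forall>x. \<Phi> s x \<in> S2) \<and>
     \<Phi> 0 = \<phi> \<and>
     (\<forall>s\<in>{-\<epsilon><..<\<epsilon>}. \<forall>x. x \<notin> K \<longrightarrow> \<Phi> s x = \<phi> x)"

definition sigma2_critical :: "(real^3 \<Rightarrow> real) \<Rightarrow> (real^3 \<Rightarrow> real^3) \<Rightarrow> bool" where
  "sigma2_critical P \<phi> \<longleftrightarrow>
     (\<forall>K \<epsilon> \<Phi>. compact_domain K \<longrightarrow> variation \<phi> K \<epsilon> \<Phi> \<longrightarrow>
        ((\<lambda>s. 1/2 * (LINT x:K|lborel. energy_density P (\<Phi> s) x)) has_real_derivative 0) (at 0))"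

definition FS_field :: "(real^3 \<Rightarrow> real^3) \<Rightarrow> bool" where
  "FS_field \<phi> \<longleftrightarrow> (\<forall>x. \<phi> x \<in> S2) \<and> (\<phi> \<longlongrightarrow> vector [0, 0, 1]) at_infinity"

definition FS_solution :: "(real^3 \<Rightarrow> real) \<Rightarrow> (real^3 \<Rightarrow> real^3) \<Rightarrow> bool" where
  "FS_solution P \<phi> \<longleftrightarrow> FS_field \<phi> \<and> C2_on UNIV \<phi> \<and> sigma2_critical P \<phi>"

definition axisymmetric_form ::
  "(real^3 \<Rightarrow> real^3) \<Rightarrow> int \<Rightarrow> int \<Rightarrow> (real \<Rightarrow> real \<Rightarrow> real) \<Rightarrow> (real \<Rightarrow> real \<Rightarrow> real) \<Rightarrow> bool" where
  "axisymmetric_form \<phi> k l \<Theta> \<psi> \<longleftrightarrow>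
     (\<forall>\<rho> \<theta> z. 0 \<le> \<rho> \<longrightarrow>
        \<phi> (cr (complex_of_real \<rho> * cis \<theta>) z) =
        cr (complex_of_real (sin (\<Theta> \<rho> z)) * cis (of_int l * \<theta> - of_int k * \<psi> \<rho> z))
           (cos (\<Theta> \<rho> z)))"

definition axisymmetric_no_swirl :: "(real^3 \<Rightarrow> real^3) \<Rightarrow> bool" where
  "axisymmetric_no_swirl \<phi> \<longleftrightarrow>
     (\<exists>k l \<Theta> \<psi>. axisymmetric_form \<phi> k l \<Theta> \<psi> \<and>
        (\<exists>A. \<forall>\<rho> z. 0 \<le> \<rho> \<longrightarrow> \<psi> \<rho> z = A (\<Theta> \<rho> z)))"


subsection \<open>The eigenvalues in the definition of \<open>wedge2_sq\<close> exist and determine its value\<close>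

lemma eigenvalues3_unique:
  assumes "eigenvalues3 C m1 m2 m3" "eigenvalues3 C n1 n2 n3"
  shows "m1 * m2 + m1 * m3 + m2 * m3 = n1 * n2 + n1 * n3 + n2 * n3"
proof -
  have eq: "(t - m1) * (t - m2) * (t - m3) = (t - n1) * (t - n2) * (t - n3)" for t
    using assms unfolding eigenvalues3_def by metis
  show ?thesis
    using eq[of 0] eq[of 1] eq[of "-1"] by (simp add: algebra_simps)
qed

lemma quadratic_roots:
  fixes p q r :: real
  obtains u v where "\<And>t. (t - p) * (t - q) - r\<^sup>2 = (t - u) * (t - v)"
proof -
  define d where "d = sqrt ((p - q)\<^sup>2 + 4 * r\<^sup>2)"
  have d: "d * d = (p - q)\<^sup>2 + 4 * r\<^sup>2"
    unfolding d_def by simp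
  have "(t - p) * (t - q) - r\<^sup>2 = (t - (p + q + d) / 2) * (t - (p + q - d) / 2)" for t
    using d by (simp add: field_simps power2_eq_square)
  then show thesis by (rule that)
qed

lemma eigenvalues3_exist:
  fixes C :: "real^3^3"
  assumes sym: "transpose C = C"
  shows "\<exists>m1 m2 m3. eigenvalues3 C m1 m2 m3"
proof -
  define c0 where "c0 = det (mat 0 - C)"
  define c2 where "c2 = - (C$1$1 + C$2$2 + C$3$3)"
  define c1 where "c1 = C$1$1 * C$2$2 + C$1$1 * C$3$3 + C$2$2 * C$3$3
    - C$1$2 * C$2$1 - C$1$3 * C$3$1 - C$2$3 * C$3$2"
  have p: "det (mat t - C) = t^3 + c2 * t^2 + c1 * t + c0" for t
    unfolding c0_def c1_def c2_def
    by (simp add: det_3 mat_def algebra_simps power2_eq_square power3_eq_cube)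
  have "\<exists>t. t^3 + c2 * t^2 + c1 * t + c0 = 0"
  proof -
    define M where "M = 1 + \<bar>c2\<bar> + \<bar>c1\<bar> + \<bar>c0\<bar>"
    have M: "M \<ge> 1" by (simp add: M_def)
    have bnd: "\<bar>c2 * t^2 + c1 * t + c0\<bar> \<le> M^3" if "\<bar>t\<bar> = M" for t
    proof -
      have t2: "t^2 = M^2" using that by (metis power2_abs)
      have MM: "M \<le> M^2" "1 \<le> M^2"
        using M by (simp_all add: self_le_power)
      have "\<bar>c2 * t^2 + c1 * t + c0\<bar> \<le> \<bar>c2\<bar> * M^2 + \<bar>c1\<bar> * M + \<bar>c0\<bar>"
      proof -
        have "\<bar>c2 * t^2\<bar> = \<bar>c2\<bar> * M^2" "\<bar>c1 * t\<bar> = \<bar>c1\<bar> * M"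
          using that t2 by (simp_all add: abs_mult)
        then show ?thesis by linarith
      qed
      also have "\<dots> \<le> \<bar>c2\<bar> * M^2 + \<bar>c1\<bar> * M^2 + \<bar>c0\<bar> * M^2"
        using mult_left_mono[OF MM(1), of "\<bar>c1\<bar>"] mult_left_mono[OF MM(2), of "\<bar>c0\<bar>"] by simp
      also have "\<dots> = (M - 1) * M^2"
        by (simp add: M_def algebra_simps)
      also have "\<dots> \<le> M * M^2"
        by (intro mult_right_mono) auto
      also have "\<dots> = M^3" by (simp add: power2_eq_square power3_eq_cube)
      finally show ?thesis .
    qed
    have "\<exists>t\<ge>-M. t \<le> M \<and> t^3 + c2 * t^2 + c1 * t + c0 = 0"
    proof (rule IVT')
      show "(-M)^3 + c2 * (-M)^2 + c1 * (-M) + c0 \<le> 0"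
        using bnd[of "-M"] M by (simp add: power3_eq_cube abs_le_iff)
      show "0 \<le> M^3 + c2 * M^2 + c1 * M + c0"
        using bnd[of M] M by (simp add: abs_le_iff)
      show "continuous_on {-M..M} (\<lambda>t. t^3 + c2 * t^2 + c1 * t + c0)"
        by (intro continuous_intros)
    qed (use M in simp)
    then show ?thesis by blast
  qed
  then obtain m1 where "det (mat m1 - C) = 0"
    using p by metis
  then have "\<exists>x. x \<noteq> 0 \<and> (mat m1 - C) *v x = 0"
    by (metis invertible_det_nz invertible_left_inverse matrix_left_invertible_ker)
  then obtain x where x: "x \<noteq> 0" "(mat m1 - C) *v x = 0"
    by blast
  define v where "v = (1 / norm x) *\<^sub>R x"
  have v: "norm v = 1" using x by (simp add: v_def)
  have mv: "mat t *v y = t *\<^sub>R y" for t and y :: "real^3"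
    by (simp add: vec_eq_iff matrix_vector_mult_def mat_def if_distrib if_distribR
        sum.delta cong: if_cong)
  have "C *v x = m1 *\<^sub>R x"
    using x(2) by (simp add: matrix_vector_mult_diff_rdistrib mv)
  then have Cv: "C *v v = m1 *\<^sub>R v"
    by (simp add: v_def matrix_vector_mult_scaleR)
  obtain Q where Q: "orthogonal_matrix Q" "Q *v axis (1::3) 1 = v"
    using orthogonal_matrix_exists_basis[OF v] by metis
  define B where "B = transpose Q ** C ** Q"
  have QQ: "transpose Q ** Q = mat 1" using Q(1) by (simp add: orthogonal_matrix)
  have symB: "transpose B = B"
    unfolding B_def by (simp add: matrix_transpose_mul sym matrix_mul_assoc)
  have "B *v axis 1 1 = transpose Q *v (C *v (Q *v axis 1 1))"
    by (simp add: B_def matrix_vector_mul_assoc matrix_mul_assoc)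
  also have "\<dots> = m1 *\<^sub>R (transpose Q *v (Q *v axis 1 1))"
    using Cv Q(2) by (simp add: matrix_vector_mult_scaleR)
  also have "\<dots> = m1 *\<^sub>R axis 1 1"
    unfolding matrix_vector_mul_assoc QQ by simp
  finally have col: "B *v axis 1 1 = m1 *\<^sub>R axis 1 1" .
  have colB: "B$i$1 = (if i = 1 then m1 else 0)" for i
  proof -
    have "B$i$1 = (B *v axis 1 1)$i"
      by (simp add: matrix_vector_mult_basis column_def)
    then show ?thesis
      unfolding col by (simp add: axis_def)
  qed
  have sB: "B$i$j = B$j$i" for i j
    using arg_cong[OF symB, of "\<lambda>M. M$j$i"] by (simp add: transpose_def)
  have dB: "det (mat t - C) = det (mat t - B)" for t
  proof -
    have "transpose Q ** (mat t - C) ** Q = mat t - B"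
    proof -
      have "(transpose Q ** (mat t - C) ** Q) *v y = (mat t - B) *v y" for y
      proof -
        have "(transpose Q ** (mat t - C) ** Q) *v y
            = transpose Q *v ((mat t - C) *v (Q *v y))"
          by (simp add: matrix_vector_mul_assoc matrix_mul_assoc)
        also have "\<dots> = t *\<^sub>R ((transpose Q ** Q) *v y) - B *v y"
          by (simp add: matrix_vector_mult_diff_rdistrib matrix_vector_mult_diff_distrib mv
              matrix_vector_mult_scaleR B_def flip: matrix_vector_mul_assoc)
        finally show ?thesis
          by (simp add: QQ matrix_vector_mult_diff_rdistrib mv)
      qed
      then show ?thesis by (simp add: matrix_eq)
    qed
    moreover have "det (transpose Q) * det Q = 1"
      by (metis QQ det_I det_mul)
    ultimately show ?thesis
      using det_mul[of "transpose Q ** (mat t - C)" Q] det_mul[of "transpose Q" "mat t - C"]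
      by (simp add: mult.commute mult.left_commute)
  qed
  obtain m2 m3 where q:
    "\<And>t. (t - B$2$2) * (t - B$3$3) - (B$2$3)\<^sup>2 = (t - m2) * (t - m3)"
    using quadratic_roots by metis
  have "det (mat t - B) = (t - m1) * ((t - B$2$2) * (t - B$3$3) - (B$2$3)\<^sup>2)" for t
    using colB[of 1] colB[of 2] colB[of 3] sB[of 1 2] sB[of 1 3] sB[of 3 2]
    by (simp add: det_3 mat_def algebra_simps power2_eq_square)
  then show ?thesis
    unfolding eigenvalues3_def dB q by (metis mult.assoc)
qed

lemma wedge2_sq_eq:
  assumes "eigenvalues3 (cauchy_green \<phi> x) m1 m2 m3"
  shows "wedge2_sq \<phi> x = m1 * m2 + m1 * m3 + m2 * m3"
  unfolding wedge2_sq_def using assms eigenvalues3_unique by (intro the_equality) blast+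

lemma wedge2_sq_eigenvalues:
  obtains m1 m2 m3 where "eigenvalues3 (cauchy_green \<phi> x) m1 m2 m3"
    "wedge2_sq \<phi> x = m1 * m2 + m1 * m3 + m2 * m3"
proof -
  have "transpose (cauchy_green \<phi> x) = cauchy_green \<phi> x"
    by (simp add: cauchy_green_def Let_def matrix_transpose_mul)
  then show thesis
    using eigenvalues3_exist wedge2_sq_eq that by metis
qed

end

(*
  Let B be the vector field dual to the pulled back area form, so that |B|^2 is the first term of the
  energy density. Inner variations along a compactly supported field X give
    INT (|B|^2/2 - P) div X - B . DX B = 0.
  Axial symmetry yields rho B_rho = l d_z(phi_3), and the absence of swirls yields B_theta = 0.
  Take X = u^3 rho d_rho / (eps^2 + rho^2) with a cutoff u = max 0 (1 - |x|^2/R^2). The terms in which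
  no derivative falls on u combine to u^3 (eps^2 B_3^2 + (rho B_rho)^2 - 2 eps^2 P) / (eps^2 + rho^2)^2, and
  the remaining ones are bounded by 21 |B|^2/R^2 after absorption.

  If l is not 0, then phi_3 is constant on the axis, hence equal to 1 there, so P vanishes on the axis. As
  eps -> 0 the weight eps^2/(eps^2 + rho^2)^2 concentrates on the axis with bounded mass, so the P-term
  vanishes; R -> infinity and finite energy then force rho B_rho = 0, so phi_3 does not depend on z.
  If l = 0, then B = 0, and eps = 1, R -> infinity force P(phi) = 0. In both cases phi_3 = 1.
*)
theory Submission
  imports Defs
begin

text \<open>The sign is decided by the absence of swirls: with q = eps^2 + rho^2, the part of the
  integrand free of derivatives of u carries B_rho^2 with the factor rho^2/q^2 but B_theta^2 with
  -rho^2/q^2, so B_theta must vanish before anything can be concluded. The obstacle is that Theta,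
  psi and A are arbitrary real functions, possibly discontinuous, so the ansatz cannot be
  differentiated in rho or z. Only the rotation in theta can, which yields rho B_rho = l d_z(phi_3);
  the vanishing of B_theta needs a topological argument instead. The limit field d_rho/rho is
  singular on the axis and its divergence is 2 pi times the length measure of the axis. This
  explains both the regularisation by eps and why the values of P on the axis are all that survives.
  The order of choices matters: eps is taken small depending on R, since the concentration is not
  uniform in R. In the end only eps <= 1 is needed to bound the weight on (rho B_rho)^2 from below
  on a fixed cube.\<close>

section \<open>Calculus of C1 and C2 maps\<close>

lemma C1_onI:
  assumes "open S" "\<And>x. x \<in> S \<Longrightarrow> (f has_derivative blinfun_apply (f' x)) (at x)"
    and "continuous_on S f'"
  shows "C1_on S f"
  using assms unfolding C1_on_def by blast

lemma C2_onI:
  assumes "\<And>x. x \<in> S \<Longrightarrow> (f has_derivative blinfun_apply (f' x)) (at x)"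
    and "C1_on S f'"
  shows "C2_on S f"
  using assms unfolding C2_on_def C1_on_def by blast

lemma C1_on_imp_continuous_on: "C1_on S f \<Longrightarrow> continuous_on S f"
  unfolding C1_on_def
  by (metis continuous_at_imp_continuous_on has_derivative_continuous)

lemma C2_on_imp_C1_on: "C2_on S f \<Longrightarrow> C1_on S f"
  unfolding C2_on_def
  by (metis C1_onI C1_on_imp_continuous_on)

lemma C1_on_const: "open S \<Longrightarrow> C1_on S (\<lambda>x. c)"
  by (rule C1_onI[where f' = "\<lambda>x. 0"]) (auto simp: zero_blinfun.rep_eq)

lemma C2_on_const: "open S \<Longrightarrow> C2_on S (\<lambda>x. c)"
  by (rule C2_onI[where f' = "\<lambda>x. 0"]) (auto intro: C1_on_const simp: zero_blinfun.rep_eq)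

lemma C2_on_bounded_linear:
  assumes "open S" "bounded_linear f"
  shows "C2_on S f"
proof (rule C2_onI[where f' = "\<lambda>x. Blinfun f"])
  show "(f has_derivative blinfun_apply (Blinfun f)) (at x)" for x
    using assms by (simp add: bounded_linear_Blinfun_apply bounded_linear_imp_has_derivative)
qed (intro C1_on_const assms)

lemma C1_on_add:
  assumes "C1_on S f" "C1_on S g"
  shows "C1_on S (\<lambda>x. f x + g x)"
proof -
  obtain f' g' where
    f: "open S" "\<And>x. x \<in> S \<Longrightarrow> (f has_derivative blinfun_apply (f' x)) (at x)" "continuous_on S f'"
    and g: "\<And>x. x \<in> S \<Longrightarrow> (g has_derivative blinfun_apply (g' x)) (at x)" "continuous_on S g'"
    using assms unfolding C1_on_def by metis
  show ?thesis
    by (rule C1_onI[where f' = "\<lambda>x. f' x + g' x"])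
      (auto intro!: f g continuous_intros derivative_eq_intros simp: blinfun.bilinear_simps fun_eq_iff)
qed

lemma C2_on_add:
  assumes "C2_on S f" "C2_on S g"
  shows "C2_on S (\<lambda>x. f x + g x)"
proof -
  obtain f' g' where
    f: "\<And>x. x \<in> S \<Longrightarrow> (f has_derivative blinfun_apply (f' x)) (at x)" "C1_on S f'"
    and g: "\<And>x. x \<in> S \<Longrightarrow> (g has_derivative blinfun_apply (g' x)) (at x)" "C1_on S g'"
    using assms unfolding C2_on_def by metis
  show ?thesis
    by (rule C2_onI[where f' = "\<lambda>x. f' x + g' x"])
      (auto intro!: f g C1_on_add derivative_eq_intros simp: blinfun.bilinear_simps fun_eq_iff)
qed

lemma C1_on_compose:
  assumes "C1_on T g" "C1_on S f" "f ` S \<subseteq> T"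
  shows "C1_on S (\<lambda>x. g (f x))"
proof -
  obtain f' g' where
    f: "open S" "\<And>x. x \<in> S \<Longrightarrow> (f has_derivative blinfun_apply (f' x)) (at x)" "continuous_on S f'"
    and g: "\<And>x. x \<in> T \<Longrightarrow> (g has_derivative blinfun_apply (g' x)) (at x)" "continuous_on T g'"
    using assms unfolding C1_on_def by metis
  show ?thesis
  proof (rule C1_onI[where f' = "\<lambda>x. g' (f x) o\<^sub>L f' x"])
    show "((\<lambda>x. g (f x)) has_derivative blinfun_apply (g' (f x) o\<^sub>L f' x)) (at x)" if "x \<in> S" for x
      using diff_chain_at[OF f(2)[OF that] g(1)] assms(3) that by (auto simp: o_def blinfun_compose.rep_eq)
    show "continuous_on S (\<lambda>x. g' (f x) o\<^sub>L f' x)"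
      using assms(3) f(3) g(2) C1_on_imp_continuous_on[OF assms(2)]
      by (intro continuous_intros continuous_on_compose2[OF g(2)]) auto
  qed (rule f)
qed

lemma C1_on_bounded_linear:
  assumes "bounded_linear h" "C1_on S f"
  shows "C1_on S (\<lambda>x. h (f x))"
  using C1_on_compose[OF C2_on_imp_C1_on[OF C2_on_bounded_linear[OF open_UNIV assms(1)]] assms(2)]
  by simp

text \<open>An arbitrary bounded bilinear product covers multiplication, scaling, inner and cross
  products. It also covers the composition of linear maps, through which
  \<open>C2_on_compose\<close> differentiates the chain rule once more.\<close>

lemma C1_on_bilinear:
  assumes "bounded_bilinear pr" "C1_on S f" "C1_on S g"
  shows "C1_on S (\<lambda>x. pr (f x) (g x))"
proof -
  interpret bounded_bilinear pr by fact
  obtain f' g' where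
    f: "open S" "\<And>x. x \<in> S \<Longrightarrow> (f has_derivative blinfun_apply (f' x)) (at x)" "continuous_on S f'"
    and g: "\<And>x. x \<in> S \<Longrightarrow> (g has_derivative blinfun_apply (g' x)) (at x)" "continuous_on S g'"
    using assms unfolding C1_on_def by metis
  have cf: "continuous_on S f" "continuous_on S g"
    using assms C1_on_imp_continuous_on by auto
  show ?thesis
  proof (rule C1_onI[where f' = "\<lambda>x. (prod_right (f x) o\<^sub>L g' x) + (prod_left (g x) o\<^sub>L f' x)"])
    show "((\<lambda>x. pr (f x) (g x)) has_derivative
        blinfun_apply ((prod_right (f x) o\<^sub>L g' x) + (prod_left (g x) o\<^sub>L f' x))) (at x)"
      if "x \<in> S" for x
      using FDERIV[OF f(2)[OF that] g(1)[OF that]]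
      by (simp add: blinfun.bilinear_simps fun_eq_iff bounded_linear_left bounded_linear_right
          prod_right.rep_eq prod_left.rep_eq plus_blinfun.rep_eq)
    show "continuous_on S (\<lambda>x. (prod_right (f x) o\<^sub>L g' x) + (prod_left (g x) o\<^sub>L f' x))"
      using bounded_linear_prod_right bounded_linear_prod_left
      by (intro continuous_intros f(3) g(2) bounded_linear.continuous_on[OF _ cf(1)]
         bounded_linear.continuous_on[OF _ cf(2)])
  qed (rule f)
qed

lemma C2_on_compose:
  assumes "C2_on T g" "C2_on S f" "f ` S \<subseteq> T"
  shows "C2_on S (\<lambda>x. g (f x))"
proof -
  obtain f' g' where
    f: "open S" "\<And>x. x \<in> S \<Longrightarrow> (f has_derivative blinfun_apply (f' x)) (at x)" "C1_on S f'"
    and g: "\<And>x. x \<in> T \<Longrightarrow> (g has_derivative blinfun_apply (g' x)) (at x)" "C1_on T g'"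
    using assms unfolding C2_on_def by metis
  show ?thesis
  proof (rule C2_onI[where f' = "\<lambda>x. g' (f x) o\<^sub>L f' x"])
    show "((\<lambda>x. g (f x)) has_derivative blinfun_apply (g' (f x) o\<^sub>L f' x)) (at x)" if "x \<in> S" for x
      using diff_chain_at[OF f(2)[OF that] g(1)] assms(3) that by (auto simp: o_def blinfun_compose.rep_eq)
    show "C1_on S (\<lambda>x. g' (f x) o\<^sub>L f' x)"
      by (intro C1_on_bilinear[OF bounded_bilinear_blinfun_compose] f
          C1_on_compose[OF g(2) C2_on_imp_C1_on[OF assms(2)] assms(3)])
  qed
qed

lemma C2_on_bilinear:
  assumes "bounded_bilinear pr" "C2_on S f" "C2_on S g"
  shows "C2_on S (\<lambda>x. pr (f x) (g x))"
proof -
  interpret bounded_bilinear pr by fact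
  obtain f' g' where
    f: "\<And>x. x \<in> S \<Longrightarrow> (f has_derivative blinfun_apply (f' x)) (at x)" "C1_on S f'"
    and g: "\<And>x. x \<in> S \<Longrightarrow> (g has_derivative blinfun_apply (g' x)) (at x)" "C1_on S g'"
    using assms unfolding C2_on_def by metis
  have cf: "C1_on S f" "C1_on S g"
    using assms C2_on_imp_C1_on by auto
  show ?thesis
  proof (rule C2_onI[where f' = "\<lambda>x. (prod_right (f x) o\<^sub>L g' x) + (prod_left (g x) o\<^sub>L f' x)"])
    show "((\<lambda>x. pr (f x) (g x)) has_derivative
        blinfun_apply ((prod_right (f x) o\<^sub>L g' x) + (prod_left (g x) o\<^sub>L f' x))) (at x)"
      if "x \<in> S" for x
      using FDERIV[OF f(1)[OF that] g(1)[OF that]]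
      by (simp add: blinfun.bilinear_simps fun_eq_iff bounded_linear_left bounded_linear_right
          prod_right.rep_eq prod_left.rep_eq plus_blinfun.rep_eq)
    show "C1_on S (\<lambda>x. (prod_right (f x) o\<^sub>L g' x) + (prod_left (g x) o\<^sub>L f' x))"
      by (intro C1_on_add C1_on_bilinear[OF bounded_bilinear_blinfun_compose] f g
          C1_on_bounded_linear[OF bounded_linear_prod_right]
          C1_on_bounded_linear[OF bounded_linear_prod_left] cf)
  qed
qed

lemma C1_on_real:
  fixes f :: "real \<Rightarrow> real"
  assumes "open S" "\<And>x. x \<in> S \<Longrightarrow> (f has_real_derivative f' x) (at x)" "continuous_on S f'"
  shows "C1_on S f"
proof (rule C1_onI[where f' = "\<lambda>x. blinfun_mult_right (f' x)"])
  show "(f has_derivative blinfun_apply (blinfun_mult_right (f' x))) (at x)" if "x \<in> S" for x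
    using assms(2)[OF that] by (simp add: has_field_derivative_def mult.commute)
qed (intro assms continuous_intros)+

lemma C2_on_real:
  fixes f :: "real \<Rightarrow> real"
  assumes "\<And>x. x \<in> S \<Longrightarrow> (f has_real_derivative f' x) (at x)" "C1_on S f'"
  shows "C2_on S f"
proof (rule C2_onI[where f' = "\<lambda>x. blinfun_mult_right (f' x)"])
  show "(f has_derivative blinfun_apply (blinfun_mult_right (f' x))) (at x)" if "x \<in> S" for x
    using assms(1)[OF that] by (simp add: has_field_derivative_def mult.commute)
qed (intro C1_on_bounded_linear[OF bounded_linear_blinfun_mult_right] assms)

section \<open>The vector dual to the pulled back area form\<close>

text \<open>For \<open>D\<close> the derivative of \<open>\<phi>\<close> at a point with value \<open>p\<close>, this is the vector \<open>B\<close> dual to the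
  two-form \<open>\<phi>\<^sup>*\<omega>\<close>: \<open>\<phi>\<^sup>*\<omega>(u, v) = B \<bullet> (u \<times> v)\<close>.\<close>

definition pullback_dual :: "real^3 \<Rightarrow> (real^3 \<Rightarrow> real^3) \<Rightarrow> real^3" where
  "pullback_dual p D = vector
     [p \<bullet> cross3 (D (axis 2 1)) (D (axis 3 1)),
      p \<bullet> cross3 (D (axis 3 1)) (D (axis 1 1)),
      p \<bullet> cross3 (D (axis 1 1)) (D (axis 2 1))]"

lemma vec3_expansion: "(h::real^3) = h$1 *\<^sub>R axis 1 1 + h$2 *\<^sub>R axis 2 1 + h$3 *\<^sub>R axis 3 1"
  by (simp add: vec_eq_iff forall_3 axis_def)

lemma linear_vec3_expansion:
  fixes D :: "real^3 \<Rightarrow> 'b::real_vector"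
  assumes "linear D"
  shows "D h = h$1 *\<^sub>R D (axis 1 1) + h$2 *\<^sub>R D (axis 2 1) + h$3 *\<^sub>R D (axis 3 1)"
  by (subst vec3_expansion) (simp only: linear_add[OF assms] linear_scale[OF assms])

lemma inner_vec3: "(x::real^3) \<bullet> y = x$1 * y$1 + x$2 * y$2 + x$3 * y$3"
  by (simp add: inner_vec_def sum_3)

lemma norm_pullback_dual:
  "(norm (pullback_dual p D))\<^sup>2 = (p \<bullet> cross3 (D (axis 2 1)) (D (axis 3 1)))\<^sup>2 +
     (p \<bullet> cross3 (D (axis 3 1)) (D (axis 1 1)))\<^sup>2 + (p \<bullet> cross3 (D (axis 1 1)) (D (axis 2 1)))\<^sup>2"
  unfolding power2_norm_eq_inner inner_vec3 pullback_dual_def by (simp add: power2_eq_square)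

lemma pullback_dual_cross:
  assumes "linear D"
  shows "pullback_dual p D \<bullet> cross3 u v = p \<bullet> cross3 (D u) (D v)"
  unfolding linear_vec3_expansion[OF assms, of u] linear_vec3_expansion[OF assms, of v]
    pullback_dual_def
  by (simp add: inner_vec3 cross_components) (simp add: algebra_simps)

text \<open>Both \<open>u\<close> and \<open>v\<close> are tangent at \<open>p\<close>, so their
  cross product is parallel to the unit vector \<open>p\<close> and the triple product is its signed
  length. Lagrange's identity then gives the Gram determinant.\<close>

lemma inner_cross_square:
  assumes "norm (p::real^3) = 1" "p \<bullet> u = 0" "p \<bullet> v = 0"
  shows "(p \<bullet> cross3 u v)\<^sup>2 = (u \<bullet> u) * (v \<bullet> v) - (u \<bullet> v)\<^sup>2"
proof -
  have "cross3 p (cross3 u v) = (p \<bullet> v) *\<^sub>R u - (p \<bullet> u) *\<^sub>R v"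
    by (simp add: vec_eq_iff forall_3 inner_vec3 cross_components algebra_simps)
  then have "(p \<bullet> cross3 u v)\<^sup>2 = (norm (cross3 u v))\<^sup>2"
    using norm_cross_dot[of p "cross3 u v"] assms by simp
  also have "\<dots> = (u \<bullet> u) * (v \<bullet> v) - (u \<bullet> v)\<^sup>2"
    using norm_cross_dot[of u v] by (simp add: power_mult_distrib power2_norm_eq_inner)
  finally show ?thesis .
qed

lemma det_characteristic_3:
  fixes C :: "real^3^3"
  shows "det (mat t - C) = t^3 - (C$1$1 + C$2$2 + C$3$3) * t\<^sup>2
    + (C$1$1 * C$2$2 + C$1$1 * C$3$3 + C$2$2 * C$3$3
    - C$1$2 * C$2$1 - C$1$3 * C$3$1 - C$2$3 * C$3$2) * t + det (mat 0 - C)"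
  by (simp add: det_3 mat_def algebra_simps power2_eq_square power3_eq_cube)

lemma wedge2_sq_principal_minors:
  fixes \<phi> x
  defines "C \<equiv> cauchy_green \<phi> x"
  shows "wedge2_sq \<phi> x = C$1$1 * C$2$2 + C$1$1 * C$3$3 + C$2$2 * C$3$3
    - C$1$2 * C$2$1 - C$1$3 * C$3$1 - C$2$3 * C$3$2"
proof -
  obtain m1 m2 m3 where m: "eigenvalues3 C m1 m2 m3"
    "wedge2_sq \<phi> x = m1 * m2 + m1 * m3 + m2 * m3"
    using wedge2_sq_eigenvalues unfolding C_def by metis
  have "det (mat t - C) = (t - m1) * (t - m2) * (t - m3)" for t
    using m(1) by (simp add: eigenvalues3_def)
  \<comment> \<open>The difference of the values at 1 and -1 isolates the linear coefficient of the
    characteristic polynomial, which is the second elementary symmetric function of the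
    eigenvalues.\<close>
  from this[of 0] this[of 1] this[of "-1"] det_characteristic_3[of 1 C] det_characteristic_3[of "-1" C]
  show ?thesis
    unfolding m(2) by (simp add: algebra_simps)
qed

lemma sphere_derivative_orthogonal:
  assumes "(\<phi> has_derivative D) (at x)" "\<And>y. norm (\<phi> y) = (1::real)"
  shows "\<phi> x \<bullet> D h = 0"
proof -
  have "((\<lambda>y. \<phi> y \<bullet> \<phi> y) has_derivative (\<lambda>h. \<phi> x \<bullet> D h + D h \<bullet> \<phi> x)) (at x)"
    by (intro derivative_intros assms)
  moreover have "(\<lambda>y. \<phi> y \<bullet> \<phi> y) = (\<lambda>y. 1)"
    using assms(2) by (simp add: fun_eq_iff flip: power2_norm_eq_inner)
  ultimately have "(\<lambda>h. \<phi> x \<bullet> D h + D h \<bullet> \<phi> x) = (\<lambda>h. 0)"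
    by (metis has_derivative_const has_derivative_unique)
  then show ?thesis
    by (metis add_cancel_left_left double_zero inner_commute)
qed

text \<open>The Cauchy-Green tensor is the Gram matrix of the three partial derivatives, and each
  squared component of the dual vector is one of its principal 2 by 2 minors.\<close>

lemma wedge2_sq_pullback_dual:
  assumes "(\<phi> has_derivative D) (at x)" "\<And>y. norm (\<phi> y) = 1"
  shows "wedge2_sq \<phi> x = (norm (pullback_dual (\<phi> x) D))\<^sup>2"
proof -
  have C: "cauchy_green \<phi> x $ i $ j = D (axis i 1) \<bullet> D (axis j 1)" for i j
    using frechet_derivative_at[OF assms(1)]
    by (simp add: cauchy_green_def Let_def matrix_matrix_mult_def transpose_def matrix_def inner_vec_def)
  note sq = inner_cross_square[OF assms(2)[of x] sphere_derivative_orthogonal[OF assms]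
      sphere_derivative_orthogonal[OF assms]]
  show ?thesis
    unfolding norm_pullback_dual sq wedge2_sq_principal_minors C
    by (simp add: power2_eq_square inner_commute algebra_simps)
qed

section \<open>Differentiation under the integral and integration by parts\<close>

lemma C2_on_derivative_C1:
  assumes "C2_on S f" "\<And>x. x \<in> S \<Longrightarrow> (f has_derivative f' x) (at x)"
  shows "C1_on S (\<lambda>x. f' x v)"
proof -
  obtain g where g: "\<And>x. x \<in> S \<Longrightarrow> (f has_derivative blinfun_apply (g x)) (at x)" "C1_on S g"
    using assms unfolding C2_on_def by metis
  have 1: "C1_on S (\<lambda>x. blinfun_apply (g x) v)"
    by (rule C1_on_bounded_linear[OF _ g(2)]) (rule blinfun.bounded_linear_left)
  have eq: "f' x v = blinfun_apply (g x) v" if "x \<in> S" for x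
    using has_derivative_unique[OF assms(2)[OF that] g(1)[OF that]] by simp
  obtain h where h: "open S" "\<And>x. x \<in> S \<Longrightarrow> ((\<lambda>x. blinfun_apply (g x) v) has_derivative blinfun_apply (h x)) (at x)"
    "continuous_on S h"
    using 1 unfolding C1_on_def by metis
  show ?thesis
  proof (rule C1_onI[OF h(1) _ h(3)])
    show "((\<lambda>x. f' x v) has_derivative blinfun_apply (h x)) (at x)" if "x \<in> S" for x
      using has_derivative_transform_within_open[OF h(2)[OF that] h(1) that] eq by simp
  qed
qed

text \<open>The partial derivative enters as a free function \<open>d\<close>, so that a caller can
  supply its own closed form. Its continuity comes from joint differentiability of \<open>h\<close>,
  and uniqueness of derivatives identifies the two.\<close>

lemma leibniz_C1:
  fixes h :: "real \<times> 'a::euclidean_space \<Rightarrow> real"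
  assumes h: "C1_on UNIV h"
    and d: "\<And>x. ((\<lambda>s. h (s, x)) has_real_derivative d x) (at s0)"
  shows "((\<lambda>s. integral (cbox a b) (\<lambda>x. h (s, x))) has_real_derivative integral (cbox a b) d) (at s0)"
    and "d integrable_on cbox a b"
proof -
  obtain h' where h': "\<And>x. (h has_derivative blinfun_apply (h' x)) (at x)" "continuous_on UNIV h'"
    using h unfolding C1_on_def by auto
  have fx: "((\<lambda>s. h (s, x)) has_real_derivative h' (s, x) (1, 0)) (at s within UNIV)" for s x
  proof -
    have "((\<lambda>s. h (s, x)) has_derivative (\<lambda>r. h' (s, x) (r, 0))) (at s)"
      using has_derivative_compose[OF has_derivative_Pair[OF has_derivative_ident has_derivative_const] h'(1)] .
    moreover have "(\<lambda>r. h' (s, x) (r, 0)) = (*) (h' (s, x) (1, 0))"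
    proof
      fix r :: real
      have "(r, 0::'a) = r *\<^sub>R (1, 0)" by simp
      then show "h' (s, x) (r, 0) = h' (s, x) (1, 0) * r"
        by (metis blinfun.scaleR_right mult.commute real_scaleR_def)
    qed
    ultimately show ?thesis
      unfolding has_field_derivative_def by metis
  qed
  have cont: "continuous_on T (\<lambda>z. h' z (1, 0))" for T
    by (intro continuous_intros continuous_on_subset[OF h'(2)]) auto
  have conth: "continuous_on T (\<lambda>x. h (s, x))" for T s
    by (rule continuous_on_compose2[OF C1_on_imp_continuous_on[OF h]]) (auto intro!: continuous_intros)
  have deq: "d = (\<lambda>x. h' (s0, x) (1, 0))"
    using DERIV_unique[OF d] fx by (auto simp: fun_eq_iff)
  have "((\<lambda>s. integral (cbox a b) (\<lambda>x. h (s, x))) has_field_derivative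
      integral (cbox a b) (\<lambda>x. h' (s0, x) (1, 0))) (at s0 within UNIV)"
    by (rule leibniz_rule_field_derivative)
      (use fx conth cont in \<open>simp_all add: integrable_continuous case_prod_beta'\<close>)
  then show "((\<lambda>s. integral (cbox a b) (\<lambda>x. h (s, x))) has_real_derivative integral (cbox a b) d) (at s0)"
    by (simp add: deq)
  show "d integrable_on cbox a b"
    unfolding deq
    by (intro integrable_continuous continuous_on_compose2[OF cont]) (auto intro!: continuous_intros)
qed

lemma has_vector_derivative_along_line:
  fixes g :: "'a::real_normed_vector \<Rightarrow> 'b::real_normed_vector"
  assumes "(g has_derivative g') (at x)"
  shows "((\<lambda>s. g (x + s *\<^sub>R v)) has_vector_derivative g' v) (at 0)"
proof -
  have "((\<lambda>s. g (x + s *\<^sub>R v)) has_derivative (\<lambda>s. g' (s *\<^sub>R v))) (at 0)"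
  proof (rule has_derivative_compose[of _ _ _ _ g])
    show "((\<lambda>s. x + s *\<^sub>R v) has_derivative (\<lambda>s. s *\<^sub>R v)) (at 0)"
      by (auto intro!: derivative_eq_intros)
  qed (use assms in simp)
  moreover have "g' (s *\<^sub>R v) = s *\<^sub>R g' v" for s
    using linear_scale[OF has_derivative_linear[OF assms], of s v] by simp
  ultimately show ?thesis
    by (simp add: has_vector_derivative_def)
qed

lemma has_real_derivative_along_line:
  fixes g :: "'a::real_normed_vector \<Rightarrow> real"
  assumes "(g has_derivative g') (at x)"
  shows "((\<lambda>s. g (x + s *\<^sub>R v)) has_real_derivative g' v) (at 0)"
  using has_vector_derivative_along_line[OF assms]
  by (simp add: has_real_derivative_iff_has_vector_derivative)

lemma integral_cbox_support:
  fixes G :: "'a::euclidean_space \<Rightarrow> real"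
  assumes "\<And>x. x \<notin> cbox a b \<Longrightarrow> G x = 0"
  shows "integral (cbox a b) G = integral UNIV G"
proof -
  have "(\<lambda>x. if x \<in> cbox a b then G x else 0) = G"
    using assms by auto
  then show ?thesis
    using integral_restrict_UNIV[of "cbox a b" G] by simp
qed

text \<open>Translation invariance takes the place of Fubini and the fundamental theorem: the
  integral of \<open>G (x + s v)\<close> over the box does not depend on small \<open>s\<close>, and
  its derivative at 0 is the integral in question.\<close>

lemma has_integral_derivative_compact_support:
  fixes G :: "'a::euclidean_space \<Rightarrow> real"
  assumes G: "C1_on UNIV G" "\<And>x. (G has_derivative G' x) (at x)"
    and supp: "\<And>x. norm x \<ge> R \<Longrightarrow> G x = 0"
    and box: "cball 0 (R + 1) \<subseteq> cbox a b"
  shows "((\<lambda>x. G' x v) has_integral 0) (cbox a b)"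
proof -
  define h where "h z = G (snd z + fst z *\<^sub>R v)" for z :: "real \<times> 'a"
  have h: "C1_on UNIV h"
    unfolding h_def
    by (intro C1_on_compose[OF G(1)] C1_on_add C1_on_bilinear[OF bounded_bilinear_scaleR]
        C2_on_imp_C1_on[OF C2_on_bounded_linear] C1_on_const bounded_linear_fst bounded_linear_snd) auto
  have d: "((\<lambda>s. h (s, x)) has_real_derivative G' x v) (at 0)" for x
    using has_real_derivative_along_line[OF G(2)] by (simp add: h_def)
  \<comment> \<open>The bound on \<open>s\<close> keeps the translation shorter than the margin 1
    between the support and the ball inside the box.\<close>
  have const: "integral (cbox a b) (\<lambda>x. h (s, x)) = integral UNIV G"
    if "\<bar>s\<bar> < 1 / (1 + norm v)" for s
  proof -
    have "norm (s *\<^sub>R v) \<le> 1 / (1 + norm v) * (1 + norm v)"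
      unfolding norm_scaleR using that by (intro mult_mono) auto
    also have "\<dots> = 1"
      by (simp add: add_nonneg_eq_0_iff)
    finally have s: "norm (s *\<^sub>R v) \<le> 1" .
    have "integral (cbox a b) (\<lambda>x. h (s, x)) = integral (cbox (a + s *\<^sub>R v) (b + s *\<^sub>R v)) G"
      using integral_shift_cbox_plus[of a b G "s *\<^sub>R v"] by (simp add: h_def o_def add.commute)
    also have "\<dots> = integral UNIV G"
    proof (rule integral_cbox_support)
      fix x assume "x \<notin> cbox (a + s *\<^sub>R v) (b + s *\<^sub>R v)"
      then have "x - s *\<^sub>R v \<notin> cbox a b"
        by (auto simp: mem_box inner_add_left inner_diff_left algebra_simps)
      then have "norm (x - s *\<^sub>R v) > R + 1"
        using box by force
      then have "norm x \<ge> R"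
        using s norm_triangle_ineq4[of x "s *\<^sub>R v"] by linarith
      then show "G x = 0" by (rule supp)
    qed
    finally show ?thesis .
  qed
  have "((\<lambda>s. integral (cbox a b) (\<lambda>x. h (s, x))) has_real_derivative 0) (at 0)"
  proof (rule has_field_derivative_transform_within_open)
    show "((\<lambda>s. integral UNIV G) has_real_derivative 0) (at 0)" by simp
    show "open (ball (0::real) (1 / (1 + norm v)))" by simp
    show "(0::real) \<in> ball 0 (1 / (1 + norm v))"
      by (simp add: add_pos_nonneg)
  qed (simp add: const)
  then have "integral (cbox a b) (\<lambda>x. G' x v) = 0"
    using leibniz_C1(1)[OF h d] DERIV_unique by metis
  then show ?thesis
    using leibniz_C1(2)[OF h d] by (metis has_integral_integral)
qed

lemma C1_on_UNIV_derivative: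
  assumes "C1_on UNIV f"
  obtains f' where "\<And>x. (f has_derivative f' x) (at x)"
proof -
  obtain g where g: "\<And>x. (f has_derivative blinfun_apply (g x)) (at x)"
    using assms unfolding C1_on_def by auto
  show thesis
    by (rule that[OF g])
qed

section \<open>Inner variations\<close>

lemma bounded_bilinear_cross3: "bounded_bilinear cross3"
  using bilinear_cross bilinear_conv_bounded_bilinear by blast

lemma C1_on_pullback_dual:
  assumes "C2_on S \<phi>" "\<And>x. x \<in> S \<Longrightarrow> (\<phi> has_derivative \<phi>' x) (at x)"
  shows "C1_on S (\<lambda>x. pullback_dual (\<phi> x) (\<phi>' x))"
proof -
  have S: "open S" using assms(1) by (simp add: C2_on_def)
  have eq: "pullback_dual p D =
      (p \<bullet> cross3 (D (axis 2 1)) (D (axis 3 1))) *\<^sub>R axis 1 1 +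
      (p \<bullet> cross3 (D (axis 3 1)) (D (axis 1 1))) *\<^sub>R axis 2 1 +
      (p \<bullet> cross3 (D (axis 1 1)) (D (axis 2 1))) *\<^sub>R axis 3 1" for p D
    by (subst vec3_expansion) (simp add: pullback_dual_def)
  show ?thesis
    unfolding eq
    by (intro C1_on_add C1_on_bilinear[OF bounded_bilinear_scaleR]
        C1_on_bilinear[OF bounded_bilinear_inner] C1_on_bilinear[OF bounded_bilinear_cross3]
        C2_on_imp_C1_on[OF assms(1)] C2_on_derivative_C1[OF assms] C1_on_const S)
qed

lemma set_lebesgue_integral_cbox:
  fixes f :: "'a::euclidean_space \<Rightarrow> real"
  assumes "continuous_on (cbox a b) f"
  shows "(LINT x:cbox a b|lborel. f x) = integral (cbox a b) f"
  by (rule set_borel_integral_eq_integral)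
    (use borel_integrable_compact[OF compact_cbox assms] in \<open>simp add: set_integrable_def\<close>)

lemma compact_domain_cbox:
  assumes "box a b \<noteq> {}"
  shows "compact_domain (cbox a b)"
  using assms closure_box[OF assms] convex_connected[OF convex_box(2)] unfolding compact_domain_def
  by (metis compact_cbox open_box)

text \<open>Differentiating the determinant gives (M u) x v + u x (M v) = (tr M - transpose M) (u x
  v). Applied to pairs of basis vectors and paired with \<open>B\<close> twice, this is the first
  variation of half the squared norm of the pulled back form.\<close>

lemma trace_vec3_identity:
  fixes B :: "real^3" and M :: "real^3 \<Rightarrow> real^3"
  assumes "linear M"
  shows "B$1 * (B \<bullet> (cross3 (M (axis 2 1)) (axis 3 1) + cross3 (axis 2 1) (M (axis 3 1)))) +
      B$2 * (B \<bullet> (cross3 (M (axis 3 1)) (axis 1 1) + cross3 (axis 3 1) (M (axis 1 1)))) +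
      B$3 * (B \<bullet> (cross3 (M (axis 1 1)) (axis 2 1) + cross3 (axis 1 1) (M (axis 2 1)))) =
    (M (axis 1 1) $ 1 + M (axis 2 1) $ 2 + M (axis 3 1) $ 3) * (B \<bullet> B) - B \<bullet> M B"
  unfolding linear_vec3_expansion[OF assms, of B]
  by (simp add: inner_vec3 cross_components axis_def) (simp add: algebra_simps)

lemma has_integral_divergence_compact_support:
  fixes X :: "real^3 \<Rightarrow> real^3" and g :: "real^3 \<Rightarrow> real"
  assumes g: "C1_on UNIV g" "\<And>x. (g has_derivative g' x) (at x)"
    and X: "C1_on UNIV X" "\<And>x. (X has_derivative X' x) (at x)"
    and supp: "\<And>x. norm x \<ge> R \<Longrightarrow> X x = 0"
    and box: "cball 0 (R + 1) \<subseteq> cbox a b"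
  shows "((\<lambda>x. g' x (X x) + g x * (X' x (axis 1 1) $ 1 + X' x (axis 2 1) $ 2 + X' x (axis 3 1) $ 3))
    has_integral 0) (cbox a b)"
proof -
  have "((\<lambda>x. g' x v * X x $ i + g x * X' x v $ i) has_integral 0) (cbox a b)" for i v
  proof -
    have "((\<lambda>x. g x * X' x v $ i + g' x v * X x $ i) has_integral 0) (cbox a b)"
    proof (rule has_integral_derivative_compact_support[OF _ _ _ box])
      show "C1_on UNIV (\<lambda>x. g x * X x $ i)"
        by (intro C1_on_bilinear[OF bounded_bilinear_mult] g
            C1_on_bounded_linear[OF bounded_linear_vec_nth] X)
      show "((\<lambda>x. g x * X x $ i) has_derivative (\<lambda>v. g x * X' x v $ i + g' x v * X x $ i)) (at x)" for x
        by (intro has_derivative_mult g bounded_linear.has_derivative[OF bounded_linear_vec_nth] X)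
    qed (use supp in auto)
    then show ?thesis by (simp add: add.commute)
  qed
  from has_integral_add[OF has_integral_add[OF this[of "axis 1 1" 1] this[of "axis 2 1" 2]] this[of "axis 3 1" 3]]
  have "((\<lambda>x. (g' x (axis 1 1) * X x $ 1 + g x * X' x (axis 1 1) $ 1)
     + (g' x (axis 2 1) * X x $ 2 + g x * X' x (axis 2 1) $ 2)
     + (g' x (axis 3 1) * X x $ 3 + g x * X' x (axis 3 1) $ 3)) has_integral 0) (cbox a b)" by simp
  then show ?thesis
    by (rule has_integral_eq[rotated])
      (simp add: linear_vec3_expansion[OF has_derivative_linear[OF g(2)], of _ "X _"] algebra_simps)
qed

text \<open>Criticality tested on the inner variation \<open>\<phi> \<circ> (id + s X)\<close>. Its \<open>s\<close>-derivative contains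
  \<open>X \<bullet> grad (|B|\<^sup>2 / 2 + P)\<close>, which the divergence theorem turns into a multiple of \<open>div X\<close>, so that no
  derivatives of \<open>B\<close> remain.\<close>

proposition inner_variation_identity:
  fixes \<phi> X :: "real^3 \<Rightarrow> real^3"
  assumes \<phi>: "FS_solution P \<phi>" "\<And>x. (\<phi> has_derivative \<phi>' x) (at x)"
    and P: "potential P"
    and X: "C2_on UNIV X" "\<And>x. (X has_derivative X' x) (at x)"
    and supp: "\<And>x. norm x \<ge> R \<Longrightarrow> X x = 0"
    and box: "R \<ge> 0" "cball 0 (R + 1) \<subseteq> cbox a b"
  defines "B \<equiv> \<lambda>x. pullback_dual (\<phi> x) (\<phi>' x)"
  shows "((\<lambda>x. ((norm (B x))\<^sup>2 / 2 - P (\<phi> x)) * (X' x (axis 1 1) $ 1 + X' x (axis 2 1) $ 2 + X' x (axis 3 1) $ 3)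
    - B x \<bullet> X' x (B x)) has_integral 0) (cbox a b)"
proof -
  have sphere: "norm (\<phi> x) = 1" for x
    using \<phi>(1) by (simp add: FS_solution_def FS_field_def)
  have C2: "C2_on UNIV \<phi>" and crit: "sigma2_critical P \<phi>"
    using \<phi>(1) by (auto simp: FS_solution_def)
  obtain U F where F: "S2 \<subseteq> U" "C1_on U F" "\<And>y. y \<in> S2 \<Longrightarrow> F y = P y"
    using P unfolding potential_def by blast
  define p where "p x = P (\<phi> x)" for x
  have p: "p = (\<lambda>x. F (\<phi> x))"
    using F sphere by (auto simp: p_def)
  have C1p: "C1_on UNIV p"
    unfolding p by (rule C1_on_compose[OF F(2) C2_on_imp_C1_on[OF C2]]) (use F(1) sphere in auto)
  have C1B: "C1_on UNIV B"
    unfolding B_def by (rule C1_on_pullback_dual[OF C2 \<phi>(2)])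
  obtain p' where p': "\<And>x. (p has_derivative p' x) (at x)"
    using C1_on_UNIV_derivative[OF C1p] by blast
  obtain B' where B': "\<And>x. (B has_derivative B' x) (at x)"
    using C1_on_UNIV_derivative[OF C1B] by blast
  \<comment> \<open>This is the form pulled back by \<open>\<phi>\<close> composed with x + s X(x),
    evaluated on \<open>u\<close> and \<open>v\<close>. Written through \<open>B\<close>, its
    \<open>s\<close>-derivative involves one derivative of \<open>B\<close> and none of
    \<open>X'\<close>.\<close>
  define T where "T u v z = B (snd z + fst z *\<^sub>R X (snd z)) \<bullet>
      cross3 (u + fst z *\<^sub>R X' (snd z) u) (v + fst z *\<^sub>R X' (snd z) v)" for u v :: "real^3" and z :: "real \<times> (real^3)"
  define h where "h z = ((T (axis 2 1) (axis 3 1) z)\<^sup>2 + (T (axis 3 1) (axis 1 1) z)\<^sup>2 + (T (axis 1 1) (axis 2 1) z)\<^sup>2) / 2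
      + p (snd z + fst z *\<^sub>R X (snd z))" for z
  have C1fst: "C1_on UNIV (fst :: real \<times> (real^3) \<Rightarrow> real)" and C1snd: "C1_on UNIV (snd :: real \<times> (real^3) \<Rightarrow> real^3)"
    by (auto intro!: C2_on_imp_C1_on[OF C2_on_bounded_linear] bounded_linear_fst bounded_linear_snd)
  have C1F: "C1_on UNIV (\<lambda>z::real \<times> (real^3). snd z + fst z *\<^sub>R X (snd z))"
    by (intro C1_on_add C1snd C1_on_bilinear[OF bounded_bilinear_scaleR] C1fst
        C1_on_compose[OF C2_on_imp_C1_on[OF X(1)] C1snd]) auto
  have C1T: "C1_on UNIV (T u v)" for u v
    unfolding T_def
    by (intro C1_on_bilinear[OF bounded_bilinear_inner] C1_on_compose[OF C1B C1F]
        C1_on_bilinear[OF bounded_bilinear_cross3] C1_on_add C1_on_const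
        C1_on_bilinear[OF bounded_bilinear_scaleR] C1fst
        C1_on_compose[OF C2_on_derivative_C1[OF X] C1snd]) auto
  have C1h: "C1_on UNIV h"
    unfolding h_def power2_eq_square
    by (intro C1_on_add C1_on_bounded_linear[OF bounded_linear_divide] C1_on_bilinear[OF bounded_bilinear_mult]
       C1T C1_on_compose[OF C1p C1F]) auto
  have linX: "linear (X' x)" for x
    using X(2) has_derivative_linear by blast
  have dT: "((\<lambda>s. T u v (s, x)) has_real_derivative
      B' x (X x) \<bullet> cross3 u v + B x \<bullet> (cross3 (X' x u) v + cross3 u (X' x v))) (at 0)" for u v x
  proof -
    note [derivative_intros] = bounded_bilinear.has_vector_derivative[OF bounded_bilinear_inner]
      bounded_bilinear.has_vector_derivative[OF bounded_bilinear_cross3]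
    have l: "((\<lambda>s. w + s *\<^sub>R y) has_vector_derivative y) (at 0)" for w y :: "real^3"
      by (auto intro!: derivative_eq_intros)
    have "((\<lambda>s. B (x + s *\<^sub>R X x) \<bullet> cross3 (u + s *\<^sub>R X' x u) (v + s *\<^sub>R X' x v)) has_vector_derivative
        B (x + 0 *\<^sub>R X x) \<bullet> (cross3 (u + 0 *\<^sub>R X' x u) (X' x v) + cross3 (X' x u) (v + 0 *\<^sub>R X' x v))
        + B' x (X x) \<bullet> cross3 (u + 0 *\<^sub>R X' x u) (v + 0 *\<^sub>R X' x v)) (at 0)"
      by (intro derivative_intros has_vector_derivative_along_line[OF B'] l)
    then show ?thesis
      by (simp add: T_def has_real_derivative_iff_has_vector_derivative inner_add_right algebra_simps)
  qed
  have T0: "T u v (0, x) = B x \<bullet> cross3 u v" for u v x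
    by (simp add: T_def)
  define d where "d x = B x \<bullet> B' x (X x) + (X' x (axis 1 1) $ 1 + X' x (axis 2 1) $ 2 + X' x (axis 3 1) $ 3) * (B x \<bullet> B x)
      - B x \<bullet> X' x (B x) + p' x (X x)" for x
  have dh: "((\<lambda>s. h (s, x)) has_real_derivative d x) (at 0)" for x
  proof -
    have dp: "((\<lambda>s. p (snd (s, x) + fst (s, x) *\<^sub>R X (snd (s, x)))) has_real_derivative p' x (X x)) (at 0)"
      using has_real_derivative_along_line[OF p'] by simp
    have der: "((\<lambda>s. h (s, x)) has_real_derivative
       B x $ 1 * (B' x (X x) $ 1 + B x \<bullet> (cross3 (X' x (axis 2 1)) (axis 3 1) + cross3 (axis 2 1) (X' x (axis 3 1)))) +
       B x $ 2 * (B' x (X x) $ 2 + B x \<bullet> (cross3 (X' x (axis 3 1)) (axis 1 1) + cross3 (axis 3 1) (X' x (axis 1 1)))) +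
       B x $ 3 * (B' x (X x) $ 3 + B x \<bullet> (cross3 (X' x (axis 1 1)) (axis 2 1) + cross3 (axis 1 1) (X' x (axis 2 1)))) +
       p' x (X x)) (at 0)"
      unfolding h_def
      by (rule derivative_eq_intros dT dp refl | simp add: T0 cross_basis inner_axis algebra_simps)+
    have "x1 * (y1 + z1) + x2 * (y2 + z2) + x3 * (y3 + z3) + w = d x"
      if "x1 * z1 + x2 * z2 + x3 * z3 = (X' x (axis 1 1) $ 1 + X' x (axis 2 1) $ 2 + X' x (axis 3 1) $ 3) * (B x \<bullet> B x) - B x \<bullet> X' x (B x)"
        and "B x \<bullet> B' x (X x) = x1 * y1 + x2 * y2 + x3 * y3" and "w = p' x (X x)"
      for x1 x2 x3 y1 y2 y3 z1 z2 z3 w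
      unfolding d_def that(2,3) using that(1) by (simp only: distrib_left)
    from this[OF trace_vec3_identity[OF linX, of "B x" x] inner_vec3 refl]
    show ?thesis by (rule DERIV_cong[OF der])
  qed
  have dens: "energy_density P (\<lambda>x. \<phi> (x + s *\<^sub>R X x)) x = 2 * h (s, x)" for s x
  proof -
    define D where "D = (\<lambda>v. \<phi>' (x + s *\<^sub>R X x) (v + s *\<^sub>R X' x v))"
    have D: "((\<lambda>x. \<phi> (x + s *\<^sub>R X x)) has_derivative D) (at x)"
      unfolding D_def
      by (rule has_derivative_compose[OF _ \<phi>(2)]) (auto intro!: derivative_eq_intros X)
    have "wedge2_sq (\<lambda>x. \<phi> (x + s *\<^sub>R X x)) x = (norm (pullback_dual (\<phi> (x + s *\<^sub>R X x)) D))\<^sup>2"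
      by (rule wedge2_sq_pullback_dual[OF D]) (rule sphere)
    also have "\<dots> = (T (axis 2 1) (axis 3 1) (s, x))\<^sup>2 + (T (axis 3 1) (axis 1 1) (s, x))\<^sup>2 + (T (axis 1 1) (axis 2 1) (s, x))\<^sup>2"
      unfolding norm_pullback_dual T_def D_def B_def
        pullback_dual_cross[OF has_derivative_linear[OF \<phi>(2)]]
      by simp
    finally show ?thesis
      by (simp add: energy_density_def h_def p_def)
  qed
  \<comment> \<open>The maps x + s X(x) need not be diffeomorphisms: the composite with
    \<open>\<phi>\<close> takes values in the sphere for every \<open>s\<close>, so the parameter
    range 1 is as good as any.\<close>
  have "variation \<phi> (cbox a b) 1 (\<lambda>s x. \<phi> (x + s *\<^sub>R X x))"
    unfolding variation_def
  proof (intro conjI ballI allI impI)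
    have op: "open ({- 1<..<1::real} \<times> (UNIV :: (real^3) set))"
      by (intro open_Times) auto
    have "C2_on ({- 1<..<1} \<times> UNIV) (\<lambda>z. \<phi> (snd z + fst z *\<^sub>R X (snd z)))"
      by (intro C2_on_compose[OF C2] C2_on_add C2_on_bilinear[OF bounded_bilinear_scaleR] C2_on_compose[OF X(1)]
          C2_on_bounded_linear bounded_linear_fst bounded_linear_snd op) auto
    then show "C2_on ({- 1<..<1} \<times> UNIV) (\<lambda>(s, x). \<phi> (x + s *\<^sub>R X x))"
      by (simp add: case_prod_beta')
    show "\<phi> (x + s *\<^sub>R X x) \<in> S2" for s x
      using sphere by simp
    show "\<phi> (x + s *\<^sub>R X x) = \<phi> x" if "x \<notin> cbox a b" for s x
    proof -
      have "x \<notin> cball 0 (R + 1)" using that box by blast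
      then show ?thesis using supp[of x] by simp
    qed
  qed auto
  moreover have "compact_domain (cbox a b)"
  proof (rule compact_domain_cbox)
    \<comment> \<open>Since \<open>R \<ge> 0\<close>, the box contains the unit ball; its interior
      is therefore nonempty, as a compact domain requires.\<close>
    have "ball 0 1 \<subseteq> cbox a b"
      using box by (auto simp: subset_iff)
    then have "0 \<in> interior (cbox a b)"
      by (meson centre_in_ball in_mono interior_maximal open_ball zero_less_one)
    then show "box a b \<noteq> {}" by (auto simp: interior_cbox)
  qed
  ultimately have "((\<lambda>s. 1/2 * (LINT x:cbox a b|lborel. energy_density P (\<lambda>x. \<phi> (x + s *\<^sub>R X x)) x)) has_real_derivative 0) (at 0)"
    using crit unfolding sigma2_critical_def by blast
  moreover have "1/2 * (LINT x:cbox a b|lborel. energy_density P (\<lambda>x. \<phi> (x + s *\<^sub>R X x)) x) = integral (cbox a b) (\<lambda>x. h (s, x))" for s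
  proof -
    have "continuous_on (cbox a b) (\<lambda>x. h (s, x))"
      by (rule continuous_on_compose2[OF C1_on_imp_continuous_on[OF C1h]]) (auto intro!: continuous_intros)
    then show ?thesis
      unfolding dens using set_lebesgue_integral_cbox[of a b "\<lambda>x. 2 * h (s, x)"]
      by (simp add: continuous_intros)
  qed
  ultimately have "((\<lambda>s. integral (cbox a b) (\<lambda>x. h (s, x))) has_real_derivative 0) (at 0)"
    by simp
  then have "integral (cbox a b) d = 0"
    using leibniz_C1(1)[OF C1h dh] DERIV_unique by blast
  then have 1: "(d has_integral 0) (cbox a b)"
    using leibniz_C1(2)[OF C1h dh] by (metis has_integral_integral)
  have 2: "((\<lambda>x. (B x \<bullet> B' x (X x) + p' x (X x)) + ((B x \<bullet> B x) / 2 + p x) *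
      (X' x (axis 1 1) $ 1 + X' x (axis 2 1) $ 2 + X' x (axis 3 1) $ 3)) has_integral 0) (cbox a b)"
  proof (rule has_integral_divergence_compact_support[OF _ _ C2_on_imp_C1_on[OF X(1)] X(2) supp box(2)])
    show "C1_on UNIV (\<lambda>x. (B x \<bullet> B x) / 2 + p x)"
      by (intro C1_on_add C1_on_bounded_linear[OF bounded_linear_divide] C1_on_bilinear[OF bounded_bilinear_inner] C1B C1p)
    show "((\<lambda>x. (B x \<bullet> B x) / 2 + p x) has_derivative (\<lambda>v. B x \<bullet> B' x v + p' x v)) (at x)" for x
      by (auto intro!: derivative_eq_intros B' p' simp: inner_commute)
  qed
  show ?thesis
    using has_integral_diff[OF 1 2, unfolded diff_zero]
    by (rule has_integral_eq[rotated]) (simp add: d_def p_def power2_norm_eq_inner field_simps)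
qed

section \<open>Geometry of axisymmetric maps without swirls\<close>

lemma cr_polar:
  "cr (complex_of_real s * cis \<alpha>) z =
    (s * cos \<alpha>) *\<^sub>R axis 1 1 + (s * sin \<alpha>) *\<^sub>R axis 2 1 + z *\<^sub>R axis 3 1"
  by (simp add: vec_eq_iff forall_3 axis_def cr_def)

lemma cr_polar_nth:
  "cr (complex_of_real s * cis \<alpha>) z $ 1 = s * cos \<alpha>"
  "cr (complex_of_real s * cis \<alpha>) z $ 2 = s * sin \<alpha>"
  "cr (complex_of_real s * cis \<alpha>) z $ 3 = z"
  by (simp_all add: cr_def)

lemma cr_polar_exists:
  fixes x :: "real^3"
  obtains \<rho> \<theta> where "0 \<le> \<rho>" "x = cr (complex_of_real \<rho> * cis \<theta>) (x $ 3)"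
proof -
  define w where "w = Complex (x$1) (x$2)"
  have "complex_of_real (cmod w) * cis (Arg w) = w"
    by (metis rcis_cmod_Arg rcis_def)
  then have "x = cr (complex_of_real (cmod w) * cis (Arg w)) (x $ 3)"
    by (simp add: cr_def w_def vec_eq_iff forall_3)
  then show thesis by (rule that[rotated]) simp
qed

lemma cr_polar_norm: "(norm (cr (complex_of_real s * cis \<alpha>) z))\<^sup>2 = s\<^sup>2 + z\<^sup>2"
proof -
  have "(norm (cr (complex_of_real s * cis \<alpha>) z))\<^sup>2 = s\<^sup>2 * ((cos \<alpha>)\<^sup>2 + (sin \<alpha>)\<^sup>2) + z\<^sup>2"
    unfolding power2_norm_eq_inner inner_vec3 cr_polar_nth
    by (simp only: power2_eq_square distrib_left mult.assoc mult.left_commute)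
  then show ?thesis by simp
qed

text \<open>Serves twice: with \<open>c = 1\<close> for the rotation of the domain, and with
  \<open>c = of_int l\<close> for the rotation that it induces on the sphere.\<close>

lemma cr_rotation_derivative:
  "((\<lambda>t. cr (complex_of_real s * cis (\<alpha> + c * t)) z) has_vector_derivative
     vector [- c * (s * sin \<alpha>), c * (s * cos \<alpha>), 0]) (at 0)"
proof -
  have "((\<lambda>t. (s * cos (\<alpha> + c * t)) *\<^sub>R axis 1 1 + (s * sin (\<alpha> + c * t)) *\<^sub>R axis 2 1 + z *\<^sub>R axis 3 1)
     has_vector_derivative
     (- c * (s * sin \<alpha>)) *\<^sub>R axis 1 1 + (c * (s * cos \<alpha>)) *\<^sub>R axis 2 1 + (0::real^3)) (at 0)"
    by (intro has_vector_derivative_add has_vector_derivative_scaleR[where g' = 0, simplified])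
      (auto intro!: derivative_eq_intros simp: has_real_derivative_iff_has_vector_derivative[symmetric])
  moreover have "(- c * (s * sin \<alpha>)) *\<^sub>R axis 1 1 + (c * (s * cos \<alpha>)) *\<^sub>R axis 2 1 + (0::real^3)
      = vector [- c * (s * sin \<alpha>), c * (s * cos \<alpha>), 0]"
    by (simp add: vec_eq_iff forall_3 axis_def)
  ultimately show ?thesis
    unfolding cr_polar by simp
qed

text \<open>Along a circle around the axis \<open>\<rho>\<close> and \<open>z\<close> are fixed, so
  \<open>\<Theta>\<close> and \<open>\<psi>\<close> are mere constants and the ansatz can be
  differentiated without any regularity of them.\<close>

lemma axisymmetric_rotation_derivative:
  assumes ax: "axisymmetric_form \<phi> k l \<Theta> \<psi>" and D: "(\<phi> has_derivative D) (at x)"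
  shows "D (vector [- x$2, x$1, 0]) = of_int l *\<^sub>R vector [- \<phi> x $ 2, \<phi> x $ 1, 0]"
proof -
  obtain \<rho> \<theta> where \<rho>: "0 \<le> \<rho>" and x: "x = cr (complex_of_real \<rho> * cis \<theta>) (x $ 3)"
    by (rule cr_polar_exists)
  define z where "z = x $ 3"
  define \<alpha> where "\<alpha> = of_int l * \<theta> - of_int k * \<psi> \<rho> z"
  have \<phi>: "\<phi> (cr (complex_of_real \<rho> * cis (\<theta> + 1 * t)) z) =
      cr (complex_of_real (sin (\<Theta> \<rho> z)) * cis (\<alpha> + of_int l * t)) (cos (\<Theta> \<rho> z))" for t
    using ax[unfolded axisymmetric_form_def, rule_format, OF \<rho>, of "\<theta> + t" z]
    by (simp add: \<alpha>_def algebra_simps)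
  have x12: "x $ 1 = \<rho> * cos \<theta>" "x $ 2 = \<rho> * sin \<theta>"
    using cr_polar_nth[of \<rho> \<theta> "x$3"] x by metis+
  have \<phi>x: "\<phi> x $ 1 = sin (\<Theta> \<rho> z) * cos \<alpha>" "\<phi> x $ 2 = sin (\<Theta> \<rho> z) * sin \<alpha>"
    using \<phi>[of 0] x cr_polar_nth by (simp_all add: z_def)
  have "((\<lambda>t. \<phi> (cr (complex_of_real \<rho> * cis (\<theta> + 1 * t)) z)) has_vector_derivative
      D (vector [- 1 * (\<rho> * sin \<theta>), 1 * (\<rho> * cos \<theta>), 0])) (at 0)"
    unfolding has_vector_derivative_def
  proof (rule has_derivative_eq_rhs[OF has_derivative_compose[of _ _ _ _ \<phi>]])
    show "((\<lambda>t. cr (complex_of_real \<rho> * cis (\<theta> + 1 * t)) z) has_derivative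
      (\<lambda>t. t *\<^sub>R vector [- 1 * (\<rho> * sin \<theta>), 1 * (\<rho> * cos \<theta>), 0])) (at 0)"
      using cr_rotation_derivative[of \<rho> \<theta> 1 z] by (simp add: has_vector_derivative_def)
    show "(\<phi> has_derivative D) (at (cr (complex_of_real \<rho> * cis (\<theta> + 1 * 0)) z))"
      using D x by (simp add: z_def)
  qed (simp add: fun_eq_iff linear_scale[OF has_derivative_linear[OF D]])
  moreover have "((\<lambda>t. \<phi> (cr (complex_of_real \<rho> * cis (\<theta> + 1 * t)) z)) has_vector_derivative
      vector [- of_int l * (sin (\<Theta> \<rho> z) * sin \<alpha>), of_int l * (sin (\<Theta> \<rho> z) * cos \<alpha>), 0]) (at 0)"
    unfolding \<phi> by (rule cr_rotation_derivative)
  ultimately have "D (vector [- 1 * (\<rho> * sin \<theta>), 1 * (\<rho> * cos \<theta>), 0]) =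
      vector [- of_int l * (sin (\<Theta> \<rho> z) * sin \<alpha>), of_int l * (sin (\<Theta> \<rho> z) * cos \<alpha>), 0]"
    by (rule vector_derivative_unique_at)
  then show ?thesis
    unfolding x12 \<phi>x by (simp add: vec_eq_iff forall_3)
qed

text \<open>The left side is B paired with rho e_theta x e_z = rho e_rho, hence the area form on the
  images of the rotation field and of e_z. The first image is \<open>l\<close> times the rotation
  field of the sphere, whose contraction with the area form is the differential of the
  height.\<close>

lemma axisymmetric_radial_component:
  assumes ax: "axisymmetric_form \<phi> k l \<Theta> \<psi>" and D: "(\<phi> has_derivative D) (at x)"
    and sphere: "\<And>y. norm (\<phi> y) = 1"
  shows "x$1 * pullback_dual (\<phi> x) D $ 1 + x$2 * pullback_dual (\<phi> x) D $ 2 = of_int l * D (axis 3 1) $ 3"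
proof -
  define p where "p = \<phi> x"
  define V where "V = D (axis 3 1)"
  have pV: "p$1 * V$1 + p$2 * V$2 = - (p$3 * V$3)"
    using sphere_derivative_orthogonal[OF D sphere, of "axis 3 1"] by (simp add: p_def V_def inner_vec3)
  have pp: "p$1 * p$1 + p$2 * p$2 + p$3 * p$3 = 1"
    using sphere[of x] by (metis inner_vec3 norm_eq_1 p_def)
  have "x$1 * pullback_dual p D $ 1 + x$2 * pullback_dual p D $ 2
      = pullback_dual p D \<bullet> cross3 (vector [- x$2, x$1, 0]) (axis 3 1)"
    by (simp add: inner_vec3 cross_components axis_def)
  also have "\<dots> = p \<bullet> cross3 (of_int l *\<^sub>R vector [- p $ 2, p $ 1, 0]) V"
    unfolding pullback_dual_cross[OF has_derivative_linear[OF D]] axisymmetric_rotation_derivative[OF ax D]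
    by (simp add: p_def V_def)
  also have "\<dots> = of_int l * ((p$1 * p$1 + p$2 * p$2) * V$3 - p$3 * (p$1 * V$1 + p$2 * V$2))"
    by (simp add: inner_vec3 cross_components algebra_simps)
  also have "\<dots> = of_int l * ((p$1 * p$1 + p$2 * p$2 + p$3 * p$3) * V$3)"
    unfolding pV by (simp add: algebra_simps)
  finally show ?thesis
    unfolding pp by (simp add: p_def V_def)
qed

lemma countable_cos_level: "countable {t::real. cos t = c}"
proof (cases "\<exists>s. cos s = c")
  case True
  then obtain s where s: "c = cos s" by blast
  have "{t. cos t = c} \<subseteq> (\<Union>n::int. {s + 2 * of_int n * pi, - s + 2 * of_int n * pi})"
  proof
    fix t assume "t \<in> {t. cos t = c}"
    then have "cos t = cos s" using s by simp
    then obtain n :: int where "t = s + 2 * of_int n * pi \<or> t = - s + 2 * of_int n * pi"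
      unfolding cos_eq by (auto elim!: Ints_cases)
    then show "t \<in> (\<Union>n::int. {s + 2 * of_int n * pi, - s + 2 * of_int n * pi})" by blast
  qed
  then show ?thesis
    by (rule countable_subset) auto
qed auto

text \<open>Cramer's rule: it expresses \<open>w\<close> in the basis \<open>p\<close>,
  \<open>u\<close>, \<open>v\<close> whenever their triple product is nonzero.\<close>

lemma triple_product_expansion:
  fixes p u v w :: "real^3"
  shows "(w \<bullet> cross3 u v) *\<^sub>R p + (w \<bullet> cross3 v p) *\<^sub>R u + (w \<bullet> cross3 p u) *\<^sub>R v = (p \<bullet> cross3 u v) *\<^sub>R w"
  by (simp add: vec_eq_iff forall_3 inner_vec3 cross_components) (simp add: algebra_simps)

text \<open>The function \<open>A\<close> is arbitrary, so one cannot differentiate \<open>\<psi> = A(\<Theta>)\<close>. Instead, if \<open>d\<phi>\<close> had rank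
  two on a meridian half-plane, the cone over the image of this half-plane would contain a ball and hence
  an arc of constant latitude, whereas the absence of swirls leaves only countably many image points on each
  circle of latitude.\<close>

lemma no_swirl_degenerate:
  assumes ax: "axisymmetric_form \<phi> k l \<Theta> \<psi>" and swirl: "\<And>\<rho> z. 0 \<le> \<rho> \<Longrightarrow> \<psi> \<rho> z = A (\<Theta> \<rho> z)"
    and cont: "continuous_on UNIV \<phi>" and sphere: "\<And>y. norm (\<phi> y) = 1"
    and \<rho>: "\<rho> > 0" and x: "x = cr (complex_of_real \<rho> * cis \<theta>) z"
    and D: "(\<phi> has_derivative D) (at x)"
  shows "\<phi> x \<bullet> cross3 (D (vector [cos \<theta>, sin \<theta>, 0])) (D (axis 3 1)) = 0"
proof (rule ccontr)
  define u where "u = (vector [cos \<theta>, sin \<theta>, 0] :: real^3)"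
  define J where "J = \<phi> x \<bullet> cross3 (D u) (D (axis 3 1))"
  assume "\<phi> x \<bullet> cross3 (D (vector [cos \<theta>, sin \<theta>, 0])) (D (axis 3 1)) \<noteq> 0"
  then have J: "J \<noteq> 0" by (simp add: J_def u_def)
  define L where "L v = v$1 *\<^sub>R u + v$3 *\<^sub>R axis 3 1" for v :: "real^3"
  have L: "bounded_linear L"
    unfolding L_def by (intro bounded_linear_add bounded_linear_scaleR_left
        bounded_linear_compose[OF bounded_linear_scaleR_left] bounded_linear_vec_nth)
  have Lcr: "L v = cr (complex_of_real (v$1) * cis \<theta>) (v$3)" for v
    by (simp add: L_def u_def cr_polar vec_eq_iff forall_3 axis_def)
  \<comment> \<open>The cone over the image of the half-plane: \<open>v$1\<close> and
    \<open>v$3\<close> are the coordinates \<open>\<rho>\<close> and \<open>z\<close>, and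
    \<open>v$2\<close> is the scaling factor that adds the missing third dimension.\<close>
  define \<Psi> where "\<Psi> v = v$2 *\<^sub>R \<phi> (L v)" for v
  define x0 where "x0 = (vector [\<rho>, 1, z] :: real^3)"
  have Lx0: "L x0 = x" by (simp add: Lcr x x0_def)
  define D' where "D' h = h$2 *\<^sub>R \<phi> x + h$1 *\<^sub>R D u + h$3 *\<^sub>R D (axis 3 1)" for h :: "real^3"
  have DL: "D (L h) = h$1 *\<^sub>R D u + h$3 *\<^sub>R D (axis 3 1)" for h
    unfolding L_def using linear_add[OF has_derivative_linear[OF D]] linear_scale[OF has_derivative_linear[OF D]]
    by simp
  have d\<Psi>: "(\<Psi> has_derivative D') (at x0)"
  proof -
    have "((\<lambda>v. \<phi> (L v)) has_derivative (\<lambda>h. D (L h))) (at x0)"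
      by (rule has_derivative_compose[OF bounded_linear_imp_has_derivative[OF L]]) (simp add: Lx0 D)
    from has_derivative_scaleR[OF bounded_linear_imp_has_derivative[OF bounded_linear_vec_nth] this]
    show ?thesis
      unfolding \<Psi>_def by (rule has_derivative_eq_rhs) (simp add: fun_eq_iff D'_def DL Lx0, simp add: x0_def)
  qed
  \<comment> \<open>The right inverse of \<open>D'\<close> read off from Cramer's rule.\<close>
  define g where "g w = (1 / J) *\<^sub>R (vector [w \<bullet> cross3 (D (axis 3 1)) (\<phi> x), w \<bullet> cross3 (D u) (D (axis 3 1)),
      w \<bullet> cross3 (\<phi> x) (D u)] :: real^3)" for w
  have "linear g"
    unfolding g_def by (rule linearI) (simp_all add: vec_eq_iff forall_3 inner_add_left add_divide_distrib)
  then have g: "bounded_linear g" by (simp add: linear_conv_bounded_linear)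
  have "D' (g w) = (1 / J) *\<^sub>R (J *\<^sub>R w)" for w
    unfolding J_def triple_product_expansion[of w "D u" "D (axis 3 1)" "\<phi> x", symmetric]
    by (simp add: D'_def g_def scaleR_add_right J_def)
  then have D'g: "D' \<circ> g = id" using J by auto
  \<comment> \<open>On \<open>T\<close> the radius is admissible for the ansatz, and the scaling
    factor is positive and thus equal to the norm of \<open>\<Psi> v\<close>.\<close>
  define T where "T = {v::real^3. 0 < v$1 \<and> 0 < v$2}"
  have T: "open T"
    unfolding T_def by (intro open_Collect_conj open_Collect_less continuous_intros)
  have cont\<Psi>: "continuous_on UNIV \<Psi>"
    unfolding \<Psi>_def
    by (intro continuous_intros continuous_on_compose2[OF cont] linear_continuous_on[OF L]) auto
  have "\<Psi> x0 \<in> interior (\<Psi> ` T)"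
    by (rule sussmann_open_mapping[OF open_UNIV cont\<Psi> _ d\<Psi> g D'g])
      (use \<rho> in \<open>auto simp: interior_open[OF T]\<close>, auto simp: T_def x0_def)
  then obtain e where e: "e > 0" "ball (\<Psi> x0) e \<subseteq> \<Psi> ` T"
    by (auto simp: mem_interior)
  \<comment> \<open>A point of the ball off the vertical axis is needed, since otherwise its circle
    of latitude would shrink to a point.\<close>
  obtain y where y: "y \<in> ball (\<Psi> x0) e" "y$1 \<noteq> 0"
  proof (cases "\<Psi> x0 $ 1 = 0")
    case True
    have "\<Psi> x0 + (e/2) *\<^sub>R axis 1 1 \<in> ball (\<Psi> x0) e"
      using e by (simp add: dist_norm)
    then show thesis
      by (rule that) (use e True in simp)
  next
    case False
    then show thesis using that[of "\<Psi> x0"] e by simp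
  qed
  obtain s \<alpha> where s: "0 \<le> s" and ys: "y = cr (complex_of_real s * cis \<alpha>) (y$3)"
    by (rule cr_polar_exists)
  have spos: "s > 0"
    using s y(2) ys cr_polar_nth(1)[of s \<alpha> "y$3"] by (metis less_eq_real_def mult_zero_left)
  define r where "r t = cr (complex_of_real s * cis (\<alpha> + t)) (y$3)" for t
  have "open (r -` ball (\<Psi> x0) e)"
    unfolding r_def cr_polar by (intro open_vimage open_ball continuous_intros)
  moreover have "0 \<in> r -` ball (\<Psi> x0) e"
    using y ys by (simp add: r_def)
  ultimately obtain \<delta> where \<delta>: "\<delta> > 0" "ball 0 \<delta> \<subseteq> r -` ball (\<Psi> x0) e"
    by (meson openE)
  \<comment> \<open>An arc shorter than a full turn, so that \<open>r\<close> is injective on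
    it.\<close>
  define I where "I = {0<..<min \<delta> 1}"
  have inj: "inj_on r I"
  proof (rule inj_onI)
    fix t t' assume t: "t \<in> I" "t' \<in> I" "r t = r t'"
    have "cos (\<alpha> + t) = cos (\<alpha> + t')" "sin (\<alpha> + t) = sin (\<alpha> + t')"
      using arg_cong[OF t(3), of "\<lambda>w. w$1"] arg_cong[OF t(3), of "\<lambda>w. w$2"] spos
      unfolding r_def cr_polar_nth by auto
    then have "cos (t - t') = 1"
      using cos_diff[of "\<alpha> + t" "\<alpha> + t'"] by (metis add_diff_cancel_left cos_diff cos_zero diff_self)
    moreover have "\<bar>t - t'\<bar> < 1"
      using t by (auto simp: I_def)
    ultimately show "t = t'"
      using cos_monotone_0_pi[of 0 "\<bar>t - t'\<bar>"] pi_gt3 by (cases "t = t'") auto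
  qed
  \<comment> \<open>Here the absence of swirls enters: on the half-plane of angle
    \<open>\<theta>\<close> a cone point of norm \<open>norm y\<close> is determined by the single
    number \<open>\<tau>\<close>, the value of \<open>\<Theta>\<close>. Prescribing the height
    leaves countably many such numbers.\<close>
  define G where "G \<tau> = norm y *\<^sub>R cr (complex_of_real (sin \<tau>) * cis (of_int l * \<theta> - of_int k * A \<tau>)) (cos \<tau>)" for \<tau>
  have "r ` I \<subseteq> G ` {\<tau>. cos \<tau> = y$3 / norm y}"
  proof
    fix w assume "w \<in> r ` I"
    then obtain t where t: "t \<in> I" "w = r t" by blast
    then have "t \<in> ball 0 \<delta>" by (simp add: I_def)
    then have "w \<in> \<Psi> ` T" using \<delta>(2) e(2) t(2) by blast
    then obtain v where v: "v \<in> T" "w = \<Psi> v" by blast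
    have v12: "v$1 > 0" "v$2 > 0" using v(1) by (auto simp: T_def)
    define \<tau> where "\<tau> = \<Theta> (v$1) (v$3)"
    have \<phi>: "\<phi> (L v) = cr (complex_of_real (sin \<tau>) * cis (of_int l * \<theta> - of_int k * A \<tau>)) (cos \<tau>)"
      unfolding Lcr \<tau>_def using ax[unfolded axisymmetric_form_def] swirl v12(1) by simp
    have nv: "norm w = v$2"
      using v v12 sphere by (simp add: \<Psi>_def)
    have "(norm w)\<^sup>2 = (norm y)\<^sup>2"
      unfolding t(2) r_def cr_polar_norm by (subst ys) (simp add: cr_polar_norm)
    then have ny: "v$2 = norm y" using nv by (metis norm_ge_zero power2_eq_imp_eq)
    have "w $ 3 = y $ 3" by (simp add: t(2) r_def cr_polar_nth)
    moreover have "w $ 3 = norm y * cos \<tau>"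
      unfolding v(2) \<Psi>_def \<phi> ny by (simp add: cr_polar_nth)
    ultimately have "cos \<tau> = y $ 3 / norm y"
      using ny v12(2) by (simp add: field_simps)
    moreover have "w = G \<tau>"
      unfolding v(2) \<Psi>_def \<phi> ny G_def by simp
    ultimately show "w \<in> G ` {\<tau>. cos \<tau> = y$3 / norm y}" by blast
  qed
  then have "countable (r ` I)"
    by (rule countable_subset) (intro countable_image countable_cos_level)
  then have "countable I"
    using inj by (metis countable_image_inj_eq)
  then show False
    using \<delta>(1) uncountable_open_interval[of 0 "min \<delta> 1"] by (simp add: I_def)
qed

text \<open>Since e_rho x e_z = - e_theta, degeneracy on the half-plane says that B_theta = 0. On
  the axis both sides are 0.\<close>

lemma axisymmetric_angular_component:
  assumes ax: "axisymmetric_form \<phi> k l \<Theta> \<psi>" and swirl: "\<And>\<rho> z. 0 \<le> \<rho> \<Longrightarrow> \<psi> \<rho> z = A (\<Theta> \<rho> z)"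
    and cont: "continuous_on UNIV \<phi>" and sphere: "\<And>y. norm (\<phi> y) = 1"
    and D: "(\<phi> has_derivative D) (at x)"
  shows "x$2 * pullback_dual (\<phi> x) D $ 1 = x$1 * pullback_dual (\<phi> x) D $ 2"
proof -
  obtain \<rho> \<theta> where \<rho>: "0 \<le> \<rho>" and x: "x = cr (complex_of_real \<rho> * cis \<theta>) (x $ 3)"
    by (rule cr_polar_exists)
  have x12: "x $ 1 = \<rho> * cos \<theta>" "x $ 2 = \<rho> * sin \<theta>"
    using cr_polar_nth[of \<rho> \<theta> "x$3"] x by metis+
  show ?thesis
  proof (cases "\<rho> = 0")
    case False
    have "pullback_dual (\<phi> x) D \<bullet> cross3 (vector [cos \<theta>, sin \<theta>, 0]) (axis 3 1) = 0"
      unfolding pullback_dual_cross[OF has_derivative_linear[OF D]]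
      using no_swirl_degenerate[OF ax swirl cont sphere _ x D] \<rho> False by simp
    then show ?thesis
      unfolding x12 by (simp add: inner_vec3 cross_components axis_def algebra_simps)
  qed (simp add: x12)
qed

section \<open>The cutoff and the regularised radial field\<close>

text \<open>The exponent is at least 2 so that the difference quotient at 0, a positive power of
  \<open>max 0 h\<close>, tends to 0. The cases \<open>n = 1\<close> and \<open>n = 0\<close> give
  the two derivatives of the cube.\<close>

lemma has_real_derivative_max_power:
  "((\<lambda>t. (max 0 t) ^ (n + 2)) has_real_derivative (n + 2) * (max 0 t) ^ (n + 1)) (at t)"
proof -
  consider "t < 0" | "t = 0" | "t > 0" by linarith
  then show ?thesis
  proof cases
    case 1
    have "((\<lambda>t. (max 0 t) ^ (n + 2)) has_real_derivative 0) (at t)"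
      by (rule has_field_derivative_transform_within_open[where S = "{..<0}" and f = "\<lambda>_. 0"]) (use 1 in auto)
    then show ?thesis using 1 by simp
  next
    case 2
    have "((\<lambda>h. (max 0 h) ^ (n + 1)) \<longlongrightarrow> (max 0 0) ^ (n + 1)) (at (0::real))"
      by (intro tendsto_intros)
    moreover have "(max 0 h) ^ (n + 1) = ((max 0 (0 + h)) ^ (n + 2) - (max 0 0) ^ (n + 2)) / h" if "h \<noteq> 0" for h :: real
      using that by (cases "h < 0") (auto simp: max_def)
    ultimately have "((\<lambda>h. ((max 0 (0 + h)) ^ (n + 2) - (max 0 0) ^ (n + 2)) / h) \<longlongrightarrow> 0) (at (0::real))"
      by (subst tendsto_cong[symmetric, where f = "\<lambda>h. (max 0 h) ^ (n + 1)"])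
        (auto simp: eventually_at_filter)
    then show ?thesis using 2 by (simp add: DERIV_def)
  next
    case 3
    have "((\<lambda>t. t ^ (n + 2)) has_real_derivative (n + 2) * t ^ (n + 1)) (at t)"
      by (rule derivative_eq_intros refl)+ simp
    then have "((\<lambda>t. (max 0 t) ^ (n + 2)) has_real_derivative (n + 2) * t ^ (n + 1)) (at t)"
      by (rule has_field_derivative_transform_within_open[where S = "{0<..}"]) (use 3 in auto)
    then show ?thesis using 3 by (simp add: add.commute)
  qed
qed

lemma C2_on_max_cube: "C2_on UNIV (\<lambda>t::real. (max 0 t) ^ 3)"
proof (rule C2_on_real)
  show "((\<lambda>t. (max 0 t) ^ 3) has_real_derivative 3 * (max 0 t) ^ 2) (at t)" for t :: real
    using has_real_derivative_max_power[of 1 t] by (simp add: numeral_eq_Suc)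
  show "C1_on UNIV (\<lambda>t::real. 3 * (max 0 t) ^ 2)"
  proof (rule C1_on_real)
    show "((\<lambda>t. 3 * (max 0 t) ^ 2) has_real_derivative 3 * (2 * max 0 t)) (at t)" for t :: real
      using DERIV_cmult[OF has_real_derivative_max_power[of 0 t], of 3] by (simp add: numeral_eq_Suc)
  qed (auto intro!: continuous_intros)
qed

lemma C2_on_inverse: "C2_on {0<..} (inverse :: real \<Rightarrow> real)"
proof (rule C2_on_real)
  show "(inverse has_real_derivative - inverse (t ^ 2)) (at t)" if "t \<in> {0<..}" for t :: real
    using DERIV_inverse[of t UNIV] that by (simp add: numeral_eq_Suc power_inverse)
  show "C1_on {0<..} (\<lambda>t::real. - inverse (t ^ 2))"
  proof (rule C1_on_real)
    show "((\<lambda>t. - inverse (t ^ 2)) has_real_derivative 2 * inverse (t ^ 3)) (at t)" if "t \<in> {0<..}" for t :: real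
      using that by (auto intro!: derivative_eq_intros simp: field_simps numeral_eq_Suc)
  qed (auto intro!: continuous_intros)
qed

definition cutoff :: "real \<Rightarrow> real^3 \<Rightarrow> real" where
  "cutoff R x = max 0 (1 - (x \<bullet> x) / R\<^sup>2)"

text \<open>Not the distance but its square, shifted by \<open>\<epsilon>\<^sup>2\<close> to stay
  positive on the axis.\<close>

definition axis_dist :: "real \<Rightarrow> real^3 \<Rightarrow> real" where
  "axis_dist \<epsilon> x = \<epsilon>\<^sup>2 + (x$1)\<^sup>2 + (x$2)\<^sup>2"

definition horizontal :: "real^3 \<Rightarrow> real^3" where
  "horizontal x = vector [x$1, x$2, 0]"

text \<open>The factor \<open>1 / (\<epsilon>\<^sup>2 + \<rho>\<^sup>2)\<close> makes the field \<open>\<rho> \<partial>\<^sub>\<rho>\<close> divergence free off the axis in the limit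
  \<open>\<epsilon> \<rightarrow> 0\<close>; the cube of the cutoff is the least power that is \<open>C\<^sup>2\<close>.\<close>

definition radial_field :: "real \<Rightarrow> real \<Rightarrow> real^3 \<Rightarrow> real^3" where
  "radial_field R \<epsilon> x = ((cutoff R x) ^ 3 * inverse (axis_dist \<epsilon> x)) *\<^sub>R horizontal x"

definition radial_field_deriv :: "real \<Rightarrow> real \<Rightarrow> real^3 \<Rightarrow> real^3 \<Rightarrow> real^3" where
  "radial_field_deriv R \<epsilon> x v =
    (- 6 * (cutoff R x)\<^sup>2 * (x \<bullet> v) / (R\<^sup>2 * axis_dist \<epsilon> x)
     - 2 * (cutoff R x) ^ 3 * (x$1 * v$1 + x$2 * v$2) / (axis_dist \<epsilon> x)\<^sup>2) *\<^sub>R horizontal x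
    + ((cutoff R x) ^ 3 * inverse (axis_dist \<epsilon> x)) *\<^sub>R horizontal v"

lemma axis_dist_pos: "\<epsilon> \<noteq> 0 \<Longrightarrow> axis_dist \<epsilon> x > 0"
  by (simp add: axis_dist_def add_pos_nonneg)

lemma cutoff_bounds: "0 \<le> cutoff R x" "cutoff R x \<le> 1"
  by (auto simp: cutoff_def)

lemma cutoff_eq_0:
  assumes "R > 0" "norm x \<ge> R"
  shows "cutoff R x = 0"
proof -
  have "R\<^sup>2 \<le> x \<bullet> x"
    using power_mono[OF assms(2), of 2] assms(1) by (simp add: power2_norm_eq_inner)
  then show ?thesis using assms(1) by (simp add: cutoff_def max_def)
qed

lemma continuous_on_cutoff [continuous_intros]:
  "continuous_on S f \<Longrightarrow> continuous_on S (\<lambda>x. cutoff R (f x))"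
  unfolding cutoff_def divide_inverse by (intro continuous_intros)

lemma continuous_on_axis_dist [continuous_intros]:
  "continuous_on S f \<Longrightarrow> continuous_on S (\<lambda>x. axis_dist \<epsilon> (f x))"
  unfolding axis_dist_def by (intro continuous_intros)

lemma bounded_linear_horizontal: "bounded_linear horizontal"
  unfolding linear_conv_bounded_linear[symmetric]
  by (rule linearI) (simp_all add: horizontal_def vec_eq_iff forall_3)

lemma C2_on_cutoff_cube: "C2_on UNIV (\<lambda>x. (cutoff R x) ^ 3)"
  unfolding cutoff_def diff_conv_add_uminus
  by (intro C2_on_compose[OF C2_on_max_cube] C2_on_add C2_on_const
      C2_on_compose[OF C2_on_bounded_linear[OF open_UNIV bounded_linear_minus[OF bounded_linear_divide]]]
      C2_on_bilinear[OF bounded_bilinear_inner] C2_on_bounded_linear bounded_linear_ident) auto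

lemma C2_on_radial_field:
  assumes "\<epsilon> \<noteq> 0"
  shows "C2_on UNIV (radial_field R \<epsilon>)"
proof -
  have "C2_on UNIV (\<lambda>x. axis_dist \<epsilon> x)"
    unfolding axis_dist_def power2_eq_square
    by (intro C2_on_add C2_on_const C2_on_bilinear[OF bounded_bilinear_mult] C2_on_bounded_linear
        bounded_linear_vec_nth) auto
  then have "C2_on UNIV (\<lambda>x. inverse (axis_dist \<epsilon> x))"
    by (rule C2_on_compose[OF C2_on_inverse]) (use axis_dist_pos[OF assms] in auto)
  then show ?thesis
    unfolding radial_field_def
    by (intro C2_on_bilinear[OF bounded_bilinear_scaleR] C2_on_bilinear[OF bounded_bilinear_mult]
        C2_on_cutoff_cube C2_on_bounded_linear[OF open_UNIV bounded_linear_horizontal])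
qed

lemma radial_field_has_derivative:
  assumes "\<epsilon> \<noteq> 0" "R > 0"
  shows "(radial_field R \<epsilon> has_derivative radial_field_deriv R \<epsilon> x) (at x)"
proof -
  have u: "((\<lambda>x. (cutoff R x) ^ 3) has_derivative (\<lambda>v. - 6 * (cutoff R x)\<^sup>2 * (x \<bullet> v) / R\<^sup>2)) (at x)"
  proof -
    have m: "((\<lambda>t. (max 0 t) ^ 3) has_derivative (\<lambda>h. 3 * (max 0 t) ^ 2 * h)) (at t)" for t :: real
      using has_real_derivative_max_power[of 1 t]
      by (simp add: numeral_eq_Suc has_field_derivative_def)
    have i: "((\<lambda>x. 1 - (x \<bullet> x) / R\<^sup>2) has_derivative (\<lambda>v. - 2 * (x \<bullet> v) / R\<^sup>2)) (at x)"
      using assms(2) by (auto intro!: derivative_eq_intros simp: inner_commute field_simps)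
    show ?thesis
      unfolding cutoff_def
      by (rule has_derivative_eq_rhs[OF has_derivative_compose[OF i m]]) (simp add: fun_eq_iff)
  qed
  have q: "((\<lambda>x. inverse (axis_dist \<epsilon> x)) has_derivative
      (\<lambda>v. - 2 * (x$1 * v$1 + x$2 * v$2) / (axis_dist \<epsilon> x)\<^sup>2)) (at x)"
  proof -
    have "((\<lambda>x. axis_dist \<epsilon> x) has_derivative (\<lambda>v. 2 * (x$1 * v$1 + x$2 * v$2))) (at x)"
      unfolding axis_dist_def
      by (auto intro!: derivative_eq_intros bounded_linear.has_derivative[OF bounded_linear_vec_nth]
          simp: algebra_simps)
    from Deriv.has_derivative_inverse[OF _ this] show ?thesis
      using axis_dist_pos[OF assms(1), of x]
      by (auto elim!: has_derivative_eq_rhs simp: field_simps power2_eq_square)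
  qed
  have h: "(horizontal has_derivative horizontal) (at x)"
    by (rule bounded_linear_imp_has_derivative[OF bounded_linear_horizontal])
  show ?thesis
    unfolding radial_field_def
    by (rule has_derivative_eq_rhs[OF has_derivative_scaleR[OF has_derivative_mult[OF u q] h]])
      (simp add: fun_eq_iff radial_field_deriv_def divide_inverse power_inverse algebra_simps)
qed

lemma radial_field_support:
  assumes "R > 0" "norm x \<ge> R"
  shows "radial_field R \<epsilon> x = 0"
  using cutoff_eq_0[OF assms] by (simp add: radial_field_def)

text \<open>Without cutoff, the divergence of \<open>horizontal x / q\<close> is 2/q - 2 rho^2/q^2,
  and q - rho^2 is the square of \<open>\<epsilon>\<close>. The second term comes from the gradient
  of the cutoff.\<close>

lemma radial_field_divergence:
  assumes "\<epsilon> \<noteq> 0"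
  shows "radial_field_deriv R \<epsilon> x (axis 1 1) $ 1 + radial_field_deriv R \<epsilon> x (axis 2 1) $ 2
     + radial_field_deriv R \<epsilon> x (axis 3 1) $ 3 =
    2 * (cutoff R x) ^ 3 * \<epsilon>\<^sup>2 / (axis_dist \<epsilon> x)\<^sup>2
    - 6 * (cutoff R x)\<^sup>2 * ((x$1)\<^sup>2 + (x$2)\<^sup>2) / (R\<^sup>2 * axis_dist \<epsilon> x)"
proof -
  define q where "q = axis_dist \<epsilon> x"
  have q: "q > 0" "\<epsilon>\<^sup>2 = q - (x$1)\<^sup>2 - (x$2)\<^sup>2"
    using axis_dist_pos[OF assms] by (auto simp: q_def axis_dist_def)
  have "inverse q = q / q\<^sup>2" using q(1) by (simp add: power2_eq_square divide_inverse)
  then show ?thesis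
    unfolding radial_field_deriv_def q_def[symmetric] q(2)
    by (simp add: horizontal_def axis_def inner_vec3)
      (simp add: power2_eq_square algebra_simps diff_divide_distrib add_divide_distrib)
qed

lemma radial_field_quadratic_form:
  assumes "x$2 * B$1 = x$1 * B$2"
  defines "c \<equiv> x$1 * B$1 + x$2 * B$2"
  shows "B \<bullet> radial_field_deriv R \<epsilon> x B =
    - 6 * (cutoff R x)\<^sup>2 * (c + x$3 * B$3) * c / (R\<^sup>2 * axis_dist \<epsilon> x)
     - 2 * (cutoff R x) ^ 3 * c\<^sup>2 / (axis_dist \<epsilon> x)\<^sup>2
     + (cutoff R x) ^ 3 * ((B$1)\<^sup>2 + (B$2)\<^sup>2) / axis_dist \<epsilon> x"
proof -
  have "B \<bullet> horizontal x = c" "B \<bullet> horizontal B = (B$1)\<^sup>2 + (B$2)\<^sup>2" "x \<bullet> B = c + x$3 * B$3"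
    by (simp_all add: c_def inner_vec3 horizontal_def power2_eq_square)
  then show ?thesis
    unfolding radial_field_deriv_def inner_add_right inner_scaleR_right c_def[symmetric]
    by (simp add: divide_inverse algebra_simps power2_eq_square)
qed

section \<open>Pointwise lower bound for the integrand\<close>

text \<open>Here \<open>e\<close> is the square of \<open>\<epsilon>\<close>, \<open>r\<close> is
  rho^2, \<open>s\<close> the squared horizontal part of B and \<open>b\<close> is rho B_rho;
  \<open>s * r = b\<^sup>2\<close> encodes B_theta = 0. Writing 1/q as (e + r)/q^2 splits the
  negative term into \<open>s * e\<close>, cancelled by the divergence term, and
  \<open>b\<^sup>2\<close>, which leaves one of two copies of \<open>b\<^sup>2\<close>. Half of that
  copy absorbs the cross term; 21 is 3 from the divergence of the cutoff plus 18 from the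
  absorption.\<close>

lemma stress_lower_bound:
  fixes u e r s N R z b B3 P :: real
  assumes e: "e > 0" and r: "r \<ge> 0" and u: "0 \<le> u" "u \<le> 1" and R: "R > 0" and P: "P \<ge> 0"
    and z: "u > 0 \<Longrightarrow> \<bar>z\<bar> \<le> R" and s: "s * r = b\<^sup>2" "s \<ge> 0"
  defines "q \<equiv> e + r" and "N \<equiv> s + B3\<^sup>2"
  shows "u ^ 3 * b\<^sup>2 / (2 * q\<^sup>2) - 2 * u ^ 3 * e * P / q\<^sup>2 - 21 * N / R\<^sup>2
    \<le> (N / 2 - P) * (2 * u ^ 3 * e / q\<^sup>2 - 6 * u\<^sup>2 * r / (R\<^sup>2 * q))
      - (- 6 * u\<^sup>2 * (b + z * B3) * b / (R\<^sup>2 * q) - 2 * u ^ 3 * b\<^sup>2 / q\<^sup>2 + u ^ 3 * s / q)"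
proof -
  define k where "k = 1 / q"
  define c where "c = 6 * u\<^sup>2 / R\<^sup>2"
  define U where "U = u ^ 3"
  have q: "q > 0" using e r by (simp add: q_def)
  have k: "k > 0" "k * r \<le> 1" "k * (e + r) = 1"
    using q e r by (simp_all add: k_def q_def)
  have c: "c \<ge> 0" "c \<le> 6 / R\<^sup>2"
  proof -
    have "u\<^sup>2 \<le> 1" using u by (simp add: power_le_one)
    then show "c \<le> 6 / R\<^sup>2" by (auto simp: c_def divide_simps)
  qed (simp add: c_def)
  have N: "N \<ge> 0" using s by (simp add: N_def)
  have rhs: "(N / 2 - P) * (2 * u ^ 3 * e / q\<^sup>2 - 6 * u\<^sup>2 * r / (R\<^sup>2 * q))
      - (- 6 * u\<^sup>2 * (b + z * B3) * b / (R\<^sup>2 * q) - 2 * u ^ 3 * b\<^sup>2 / q\<^sup>2 + u ^ 3 * s / q)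
    = (N / 2 - P) * (2 * U * e * k\<^sup>2 - c * r * k) + c * k * (b + z * B3) * b + 2 * U * b\<^sup>2 * k\<^sup>2 - U * s * k"
    by (simp add: k_def c_def U_def power_divide)
  have Usk: "U * s * k = U * k\<^sup>2 * (s * e + s * r)"
  proof -
    have "U * k\<^sup>2 * (s * e + s * r) = U * s * k * (k * (e + r))"
      by (simp add: algebra_simps power2_eq_square)
    then show ?thesis unfolding k(3) mult_1_right by (rule sym)
  qed
  have eq: "(N / 2 - P) * (2 * U * e * k\<^sup>2 - c * r * k) + c * k * (b + z * B3) * b + 2 * U * b\<^sup>2 * k\<^sup>2 - U * s * k
    = U * k\<^sup>2 * (e * B3\<^sup>2 + b\<^sup>2) - 2 * U * e * P * k\<^sup>2 - c * (k * r) * (N / 2) + c * k * r * P + c * k * b\<^sup>2 + c * k * (b * (z * B3))"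
  proof -
    have "c * k * (b + z * B3) * b = c * k * b\<^sup>2 + c * k * (b * (z * B3))"
      by (simp add: algebra_simps power2_eq_square)
    with Usk show ?thesis
      unfolding s(1)[symmetric] N_def by (simp add: field_simps power2_eq_square)
  qed
  have t1: "c * (k * r) * (N / 2) \<le> 3 * N / R\<^sup>2"
  proof -
    have "c * (k * r) * (N / 2) \<le> (6 / R\<^sup>2) * 1 * (N / 2)"
      by (intro mult_mono c k) (use N c k r in auto)
    then show ?thesis by simp
  qed
  \<comment> \<open>The cross term is absorbed by AM-GM: \<open>u (u k \<bar>b\<bar> - 6 \<bar>B3\<bar> / R)\<^sup>2 \<ge> 0\<close>.\<close>
  have t2: "- (c * k * (b * (z * B3))) \<le> U * k\<^sup>2 * b\<^sup>2 / 2 + 18 * N / R\<^sup>2"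
  proof -
    have "- (c * k * (b * (z * B3))) \<le> c * k * (\<bar>b\<bar> * (\<bar>z\<bar> * \<bar>B3\<bar>))"
      using abs_ge_minus_self[of "c * k * (b * (z * B3))"] c k by (simp add: abs_mult)
    also have "\<dots> \<le> c * k * (\<bar>b\<bar> * (R * \<bar>B3\<bar>))"
    proof (cases "u = 0")
      case False
      then have "\<bar>z\<bar> \<le> R" using z u by simp
      then show ?thesis using c k by (intro mult_left_mono mult_right_mono) auto
    qed (simp add: c_def)
    also have "\<dots> = 6 * u\<^sup>2 * k * \<bar>b\<bar> * (\<bar>B3\<bar> / R)"
      using R by (simp add: c_def power2_eq_square)
    also have "\<dots> \<le> U * k\<^sup>2 * b\<^sup>2 / 2 + 18 * u * (\<bar>B3\<bar> / R)\<^sup>2"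
    proof -
      have sq: "u * (u * k * a - 6 * y)\<^sup>2 = u ^ 3 * k\<^sup>2 * a\<^sup>2 + 36 * u * y\<^sup>2 - 12 * u\<^sup>2 * k * a * y" for a y
        by (simp add: algebra_simps power2_eq_square power3_eq_cube)
      have "0 \<le> u * (u * k * \<bar>b\<bar> - 6 * (\<bar>B3\<bar> / R))\<^sup>2" using u by simp
      also have "\<dots> = U * k\<^sup>2 * \<bar>b\<bar>\<^sup>2 + 36 * u * (\<bar>B3\<bar> / R)\<^sup>2 - 12 * u\<^sup>2 * k * \<bar>b\<bar> * (\<bar>B3\<bar> / R)"
        unfolding U_def by (rule sq)
      finally show ?thesis by simp
    qed
    also have "18 * u * (\<bar>B3\<bar> / R)\<^sup>2 \<le> 18 * N / R\<^sup>2"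
    proof -
      have "u * B3\<^sup>2 \<le> 1 * B3\<^sup>2" using u by (intro mult_right_mono) auto
      then have "u * B3\<^sup>2 \<le> N" using s by (simp add: N_def)
      then show ?thesis by (simp add: power_divide divide_right_mono)
    qed
    finally show ?thesis by simp
  qed
  have "U * k\<^sup>2 * (e * B3\<^sup>2) \<ge> 0" "c * k * r * P \<ge> 0" "c * k * b\<^sup>2 \<ge> 0"
    using e u c k r P by (simp_all add: U_def)
  with t1 t2 have "U * k\<^sup>2 * b\<^sup>2 / 2 - 2 * U * e * P * k\<^sup>2 - 21 * N / R\<^sup>2 \<le>
    U * k\<^sup>2 * (e * B3\<^sup>2 + b\<^sup>2) - 2 * U * e * P * k\<^sup>2 - c * (k * r) * (N / 2) + c * k * r * P + c * k * b\<^sup>2 + c * k * (b * (z * B3))"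
    by (simp add: distrib_left add_divide_distrib)
  then show ?thesis
    unfolding rhs eq by (simp add: k_def U_def power_divide)
qed

section \<open>Integrals over cubes and the concentrating weight\<close>

definition cube :: "real \<Rightarrow> (real^3) set" where
  "cube n = cbox (vector [-n, -n, -n]) (vector [n, n, n])"

lemma mem_cube: "x \<in> cube n \<longleftrightarrow> \<bar>x$1\<bar> \<le> n \<and> \<bar>x$2\<bar> \<le> n \<and> \<bar>x$3\<bar> \<le> n"
  by (auto simp: cube_def mem_box_cart forall_3)

lemma cball_subset_cube: "cball 0 n \<subseteq> cube n"
  by (auto simp: mem_cube) (meson component_le_norm_cart order_trans)+

lemma cube_mono: "m \<le> n \<Longrightarrow> cube m \<subseteq> cube n"
  by (auto simp: mem_cube)

lemma compact_cube: "compact (cube n)"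
  by (simp add: cube_def)

lemma integrable_on_cube: "continuous_on UNIV f \<Longrightarrow> f integrable_on cube n"
  for f :: "real^3 \<Rightarrow> real"
  unfolding cube_def by (rule integrable_continuous) (rule continuous_on_subset, auto)

lemma cube_component_squares:
  assumes "x \<in> cube n" "0 \<le> n"
  shows "(x$1)\<^sup>2 \<le> n\<^sup>2" "(x$2)\<^sup>2 \<le> n\<^sup>2" "(x$3)\<^sup>2 \<le> n\<^sup>2"
  using assms by (auto simp: mem_cube abs_le_square_iff[symmetric])

lemma has_integral_le_off_negligible:
  fixes f g :: "'a::euclidean_space \<Rightarrow> real"
  assumes "(f has_integral i) S" "(g has_integral j) S" "negligible N"
    and "\<And>x. x \<in> S \<Longrightarrow> x \<notin> N \<Longrightarrow> f x \<le> g x"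
  shows "i \<le> j"
proof -
  have "((\<lambda>x. if x \<in> N then f x else g x) has_integral j) S"
    by (rule has_integral_spike[OF assms(3) _ assms(2)]) auto
  from has_integral_le[OF assms(1) this] show ?thesis
    using assms(4) by auto
qed

text \<open>On a fixed cube the weight is bounded below uniformly in all large \<open>R\<close> and
  all \<open>\<epsilon> \<le> 1\<close>, so small weighted integrals force the integral of
  \<open>h\<close> there to vanish. Only one suitable pair \<open>R\<close>,
  \<open>\<epsilon>\<close> per tolerance is required, and \<open>\<epsilon>\<close> may depend on
  \<open>R\<close>.\<close>

lemma weighted_integral_vanishing:
  fixes h :: "real^3 \<Rightarrow> real"
  assumes h: "continuous_on UNIV h" "\<And>x. 0 \<le> h x"
    and small: "\<And>\<eta> R0. 0 < \<eta> \<Longrightarrow> \<exists>R \<epsilon>. R0 \<le> R \<and> 0 < \<epsilon> \<and> \<epsilon> \<le> 1 \<and>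
      integral (cube (R + 1)) (\<lambda>x. (cutoff R x) ^ 3 * h x / (axis_dist \<epsilon> x)\<^sup>2) \<le> \<eta>"
  shows "h x = 0"
proof -
  define n where "n = norm x + 1"
  have n: "n > 0" by (simp add: n_def add_nonneg_pos)
  \<comment> \<open>For \<open>R \<ge> 4 * n\<close> the cutoff is at least 3/4 on the cube, so its
    cube exceeds 1/4, and \<open>axis_dist\<close> is at most
    \<open>1 + 2 * n\<^sup>2\<close>.\<close>
  define \<kappa> where "\<kappa> = 1 / (4 * (1 + 2 * n\<^sup>2)\<^sup>2)"
  have "0 < 1 + 2 * n\<^sup>2" by (simp add: add_pos_nonneg)
  then have \<kappa>: "\<kappa> > 0" unfolding \<kappa>_def by simp
  have le: "\<kappa> * integral (cube n) h \<le> \<eta>" if \<eta>: "0 < \<eta>" for \<eta>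
  proof -
    obtain R \<epsilon> where R: "4 * n \<le> R" and \<epsilon>: "0 < \<epsilon>" "\<epsilon> \<le> 1"
      and I: "integral (cube (R + 1)) (\<lambda>x. (cutoff R x) ^ 3 * h x / (axis_dist \<epsilon> x)\<^sup>2) \<le> \<eta>"
      using small[OF \<eta>] by blast
    have cont: "continuous_on UNIV (\<lambda>x. (cutoff R x) ^ 3 * h x / (axis_dist \<epsilon> x)\<^sup>2)"
      using axis_dist_pos[of \<epsilon>] \<epsilon>(1)
      by (intro continuous_intros h) (auto simp: less_imp_neq[symmetric])
    have weight: "\<kappa> * h y \<le> (cutoff R y) ^ 3 * h y / (axis_dist \<epsilon> y)\<^sup>2" if y: "y \<in> cube n" for y
    proof -
      note sq = cube_component_squares[OF y less_imp_le[OF n]]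
      have "(4 * n)\<^sup>2 \<le> R\<^sup>2" using R n by (intro power_mono) auto
      then have R2: "16 * n\<^sup>2 \<le> R\<^sup>2" by (simp add: power_mult_distrib)
      have R2pos: "R\<^sup>2 > 0" using R n by simp
      have "y \<bullet> y \<le> 3 * n\<^sup>2" using sq by (simp add: inner_vec3 power2_eq_square)
      then have "y \<bullet> y \<le> R\<^sup>2 / 4" using R2 zero_le_power2[of n] by linarith
      then have "(y \<bullet> y) / R\<^sup>2 \<le> 1/4" using R2pos by (simp add: field_simps)
      then have "3/4 \<le> cutoff R y" unfolding cutoff_def by linarith
      then have "(3/4) ^ 3 \<le> (cutoff R y) ^ 3" by (intro power_mono) auto
      then have u: "1/4 \<le> (cutoff R y) ^ 3" by (simp add: power3_eq_cube)
      have "\<epsilon>\<^sup>2 \<le> 1" using \<epsilon> by (simp add: power_le_one)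
      then have "axis_dist \<epsilon> y \<le> 1 + 2 * n\<^sup>2" using sq by (simp add: axis_dist_def)
      then have "(axis_dist \<epsilon> y)\<^sup>2 \<le> (1 + 2 * n\<^sup>2)\<^sup>2"
        using axis_dist_pos[of \<epsilon> y] \<epsilon>(1) by (intro power_mono) auto
      then have "1 / (1 + 2 * n\<^sup>2)\<^sup>2 \<le> 1 / (axis_dist \<epsilon> y)\<^sup>2"
        using axis_dist_pos[of \<epsilon> y] \<epsilon>(1) by (intro divide_left_mono) auto
      then have "1/4 * (1 / (1 + 2 * n\<^sup>2)\<^sup>2) \<le> (cutoff R y) ^ 3 * (1 / (axis_dist \<epsilon> y)\<^sup>2)"
        using u cutoff_bounds[of R y] by (intro mult_mono) auto
      then have "\<kappa> \<le> (cutoff R y) ^ 3 / (axis_dist \<epsilon> y)\<^sup>2" by (simp add: \<kappa>_def)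
      from mult_right_mono[OF this h(2)[of y]] show ?thesis by simp
    qed
    have "\<kappa> * integral (cube n) h = integral (cube n) (\<lambda>y. \<kappa> * h y)" by simp
    also have "\<dots> \<le> integral (cube n) (\<lambda>x. (cutoff R x) ^ 3 * h x / (axis_dist \<epsilon> x)\<^sup>2)"
      by (intro integral_le integrable_on_cube cont weight) (auto intro!: continuous_intros h)
    also have "\<dots> \<le> integral (cube (R + 1)) (\<lambda>x. (cutoff R x) ^ 3 * h x / (axis_dist \<epsilon> x)\<^sup>2)"
      using R n h(2) cutoff_bounds
      by (intro integral_subset_le cube_mono integrable_on_cube cont) auto
    finally show ?thesis using I by linarith
  qed
  have "\<kappa> * integral (cube n) h \<le> 0"
    by (rule field_le_epsilon) (use le in simp)
  then have "integral (cube n) h \<le> 0" using \<kappa> by (simp add: mult_le_0_iff)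
  moreover have "0 \<le> integral (cube n) h"
    by (intro integral_nonneg integrable_on_cube h)
  ultimately have "(h has_integral 0) (cube n)"
    using integrable_integral[OF integrable_on_cube[OF h(1)], of n] by (metis antisym)
  then show ?thesis
    unfolding cube_def
  proof (rule has_integral_0_cbox_imp_0[rotated 2])
    have "(0 :: real^3) \<in> box (vector [- n, - n, - n]) (vector [n, n, n])"
      using n by (simp add: mem_box_cart forall_3)
    then show "box (vector [- n, - n, - n]) (vector [n, n, n]) \<noteq> ({} :: (real^3) set)" by blast
    have "x \<in> cube n" using cball_subset_cube[of n] by (auto simp: n_def)
    then show "x \<in> cbox (vector [- n, - n, - n]) (vector [n, n, n])" by (simp add: cube_def)
  qed (use h in \<open>auto intro: continuous_on_subset\<close>)
qed

text \<open>The divergence of the compactly supported \<open>radial_field\<close> integrates to 0,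
  so the concentrating part has the same integral as the part from the cutoff gradient, which is at
  most \<open>6 / R\<^sup>2\<close> pointwise. The bound is independent of
  \<open>\<epsilon>\<close>.\<close>

lemma radial_weight_integral_bound:
  assumes "\<epsilon> \<noteq> 0" "R > 0"
  shows "integral (cube (R + 1)) (\<lambda>x. 2 * (cutoff R x) ^ 3 * \<epsilon>\<^sup>2 / (axis_dist \<epsilon> x)\<^sup>2)
    \<le> 6 / R\<^sup>2 * measure lborel (cube (R + 1))"
proof -
  let ?w = "\<lambda>x. 2 * (cutoff R x) ^ 3 * \<epsilon>\<^sup>2 / (axis_dist \<epsilon> x)\<^sup>2"
  let ?v = "\<lambda>x. 6 * (cutoff R x)\<^sup>2 * ((x$1)\<^sup>2 + (x$2)\<^sup>2) / (R\<^sup>2 * axis_dist \<epsilon> x)"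
  have "((\<lambda>x. ?w x - ?v x) has_integral 0) (cube (R + 1))"
    using has_integral_divergence_compact_support[of "\<lambda>_. 1" "\<lambda>_ _. 0" "radial_field R \<epsilon>"
        "radial_field_deriv R \<epsilon>" R "vector [-(R+1), -(R+1), -(R+1)]" "vector [R+1, R+1, R+1]"]
      C2_on_imp_C1_on[OF C2_on_radial_field[OF assms(1)]] radial_field_has_derivative[OF assms]
      radial_field_support[OF assms(2)] cball_subset_cube[of "R + 1"]
    by (simp add: radial_field_divergence[OF assms(1)] C1_on_const cube_def)
  moreover have "((\<lambda>x. 6 / R\<^sup>2) has_integral 6 / R\<^sup>2 * measure lborel (cube (R + 1))) (cube (R + 1))"
    unfolding cube_def using has_integral_const[of "6 / R\<^sup>2"] by (simp add: mult.commute)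
  ultimately have sum: "((\<lambda>x. ?w x - ?v x + 6 / R\<^sup>2) has_integral 0 + 6 / R\<^sup>2 * measure lborel (cube (R + 1))) (cube (R + 1))"
    by (rule has_integral_add)
  have "continuous_on UNIV ?w"
    using axis_dist_pos[OF assms(1)] by (intro continuous_intros) (auto simp: less_imp_neq[symmetric])
  then have "(?w has_integral integral (cube (R + 1)) ?w) (cube (R + 1))"
    by (intro integrable_integral integrable_on_cube)
  from has_integral_le[OF this sum] show ?thesis
  proof (simp only: add_0_left, elim meta_mp)
    fix x
    have "(cutoff R x)\<^sup>2 * (((x$1)\<^sup>2 + (x$2)\<^sup>2) / axis_dist \<epsilon> x) \<le> 1 * 1"
      using cutoff_bounds[of R x] axis_dist_pos[OF assms(1), of x]
      by (intro mult_mono) (auto simp: axis_dist_def power_le_one divide_simps)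
    then have "6 / R\<^sup>2 * ((cutoff R x)\<^sup>2 * (((x$1)\<^sup>2 + (x$2)\<^sup>2) / axis_dist \<epsilon> x)) \<le> 6 / R\<^sup>2 * 1"
      by (intro mult_left_mono) auto
    then show "?w x \<le> ?w x - ?v x + 6 / R\<^sup>2" by simp
  qed
qed

text \<open>An approximate identity argument: close to the axis \<open>p\<close> is small by uniform
  continuity and the weight has bounded mass; at distance at least \<open>r\<close> the weight
  itself is of order \<open>\<epsilon>\<^sup>2 / r ^ 4\<close>.\<close>

lemma axis_concentration:
  fixes p :: "real^3 \<Rightarrow> real"
  assumes p: "continuous_on UNIV p" "\<And>x. 0 \<le> p x" "\<And>x. x$1 = 0 \<Longrightarrow> x$2 = 0 \<Longrightarrow> p x = 0"
    and R: "R > 0" and \<eta>: "\<eta> > 0"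
  shows "\<exists>\<epsilon>. 0 < \<epsilon> \<and> \<epsilon> \<le> 1 \<and>
    integral (cube (R + 1)) (\<lambda>x. 2 * (cutoff R x) ^ 3 * \<epsilon>\<^sup>2 * p x / (axis_dist \<epsilon> x)\<^sup>2) \<le> \<eta>"
proof -
  define c where "c = measure lborel (cube (R + 1))"
  have c: "c \<ge> 0" by (simp add: c_def)
  define C where "C = 6 / R\<^sup>2 * c"
  have C: "C \<ge> 0" using c by (simp add: C_def)
  \<comment> \<open>One half of \<open>\<eta>\<close> pays for the neighbourhood of the axis; adding
    1 to \<open>C\<close> avoids a zero denominator.\<close>
  define \<delta> where "\<delta> = \<eta> / (2 * (C + 1))"
  have \<delta>: "\<delta> > 0" "\<delta> * C \<le> \<eta> / 2"
    using \<eta> C by (auto simp: \<delta>_def field_simps)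
  have contK: "continuous_on (cube (R + 1)) p"
    using p(1) continuous_on_subset by blast
  obtain r where r: "r > 0" "\<And>x y. x \<in> cube (R + 1) \<Longrightarrow> y \<in> cube (R + 1) \<Longrightarrow> dist y x < r \<Longrightarrow> dist (p y) (p x) < \<delta>"
    using compact_uniformly_continuous[OF contK compact_cube] \<delta>(1)
    unfolding uniformly_continuous_on_def by metis
  have "compact (p ` cube (R + 1))"
    using compact_continuous_image[OF contK compact_cube] .
  then obtain M where M: "M > 0" "\<And>x. x \<in> cube (R + 1) \<Longrightarrow> p x \<le> M"
    using compact_imp_bounded bounded_pos by (metis abs_le_D1 imageI real_norm_def)
  \<comment> \<open>The other half of \<open>\<eta>\<close> pays for the rest of the cube, using
    that \<open>\<epsilon>\<^sup>2 \<le> \<epsilon>\<close>.\<close>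
  define \<epsilon> where "\<epsilon> = min 1 (\<eta> * r ^ 4 / (4 * M * (c + 1)))"
  have \<epsilon>: "0 < \<epsilon>" "\<epsilon> \<le> 1"
    using \<eta> r M c by (auto simp: \<epsilon>_def)
  have \<epsilon>c: "2 * \<epsilon>\<^sup>2 * M / r ^ 4 * c \<le> \<eta> / 2"
  proof -
    have "\<epsilon>\<^sup>2 \<le> \<epsilon>" using \<epsilon> by (simp add: power2_eq_square mult_left_le)
    also have "\<epsilon> \<le> \<eta> * r ^ 4 / (4 * M * (c + 1))" by (simp add: \<epsilon>_def)
    finally have "\<epsilon>\<^sup>2 * (4 * M * (c + 1)) \<le> \<eta> * r ^ 4"
      using M c by (simp add: pos_le_divide_eq)
    moreover have "\<epsilon>\<^sup>2 * (4 * M * c) \<le> \<epsilon>\<^sup>2 * (4 * M * (c + 1))"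
      using M by (intro mult_left_mono) auto
    ultimately have "4 * \<epsilon>\<^sup>2 * M * c \<le> \<eta> * r ^ 4" by (simp add: mult_ac)
    then show ?thesis using r(1) by (simp add: field_simps)
  qed
  let ?w = "\<lambda>x. 2 * (cutoff R x) ^ 3 * \<epsilon>\<^sup>2 / (axis_dist \<epsilon> x)\<^sup>2"
  have q: "axis_dist \<epsilon> x > 0" for x using axis_dist_pos[of \<epsilon> x] \<epsilon> by simp
  have contw: "continuous_on UNIV ?w" and contwp: "continuous_on UNIV (\<lambda>x. 2 * (cutoff R x) ^ 3 * \<epsilon>\<^sup>2 * p x / (axis_dist \<epsilon> x)\<^sup>2)"
    using q by (auto intro!: continuous_intros p(1) simp: less_imp_neq[symmetric])
  have w: "0 \<le> ?w x" for x using cutoff_bounds[of R x] by simp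
  have pt: "2 * (cutoff R x) ^ 3 * \<epsilon>\<^sup>2 * p x / (axis_dist \<epsilon> x)\<^sup>2 \<le> \<delta> * ?w x + 2 * \<epsilon>\<^sup>2 * M / r ^ 4"
    if x: "x \<in> cube (R + 1)" for x
  proof -
    have eq: "2 * (cutoff R x) ^ 3 * \<epsilon>\<^sup>2 * p x / (axis_dist \<epsilon> x)\<^sup>2 = ?w x * p x" by simp
    show ?thesis
    proof (cases "(x$1)\<^sup>2 + (x$2)\<^sup>2 < r\<^sup>2")
      case True
      define y where "y = (vector [0, 0, x$3] :: real^3)"
      have "(dist y x)\<^sup>2 = (x$1)\<^sup>2 + (x$2)\<^sup>2"
        unfolding dist_norm power2_norm_eq_inner inner_vec3 y_def by (simp add: power2_eq_square)
      then have "dist y x < r" using True r(1) by (metis less_imp_le power2_less_imp_less)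
      moreover have "y \<in> cube (R + 1)" using x R by (simp add: y_def mem_cube)
      ultimately have "dist (p y) (p x) < \<delta>" using r(2) x by blast
      moreover have "p y = 0" by (rule p(3)) (simp_all add: y_def)
      ultimately have "p x \<le> \<delta>" by (simp add: dist_norm)
      then have "?w x * p x \<le> ?w x * \<delta>" using w by (intro mult_left_mono)
      moreover have "0 \<le> 2 * \<epsilon>\<^sup>2 * M / r ^ 4" using M by simp
      ultimately show ?thesis unfolding eq by (simp add: mult.commute)
    next
      case False
      then have "r\<^sup>2 \<le> axis_dist \<epsilon> x"
        unfolding axis_dist_def using zero_le_power2[of \<epsilon>] by linarith
      then have "(r\<^sup>2)\<^sup>2 \<le> (axis_dist \<epsilon> x)\<^sup>2" by (intro power_mono) auto
      then have q2: "r ^ 4 \<le> (axis_dist \<epsilon> x)\<^sup>2" by (simp flip: power_mult)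
      have "2 * (cutoff R x) ^ 3 * \<epsilon>\<^sup>2 \<le> 2 * 1 * \<epsilon>\<^sup>2"
        using cutoff_bounds[of R x] by (intro mult_right_mono mult_left_mono power_le_one) auto
      then have "?w x \<le> 2 * \<epsilon>\<^sup>2 / r ^ 4"
        using q2 r(1) cutoff_bounds[of R x] by (intro frac_le) auto
      then have "?w x * p x \<le> 2 * \<epsilon>\<^sup>2 / r ^ 4 * M"
        using M(2)[OF x] p(2) by (intro mult_mono) auto
      moreover have "0 \<le> \<delta> * ?w x" using w[of x] \<delta>(1) by (intro mult_nonneg_nonneg) auto
      ultimately show ?thesis unfolding eq by simp
    qed
  qed
  have "((\<lambda>x. \<delta> * ?w x + 2 * \<epsilon>\<^sup>2 * M / r ^ 4) has_integral
      \<delta> * integral (cube (R + 1)) ?w + 2 * \<epsilon>\<^sup>2 * M / r ^ 4 * c) (cube (R + 1))"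
    using has_integral_const[of "2 * \<epsilon>\<^sup>2 * M / r ^ 4" "vector [-(R+1), -(R+1), -(R+1)] :: real^3" "vector [R+1, R+1, R+1]"]
    by (intro has_integral_add has_integral_mult_right integrable_integral integrable_on_cube contw)
      (simp add: cube_def c_def mult.commute)
  from has_integral_le[OF integrable_integral[OF integrable_on_cube[OF contwp]] this] pt
  have "integral (cube (R + 1)) (\<lambda>x. 2 * (cutoff R x) ^ 3 * \<epsilon>\<^sup>2 * p x / (axis_dist \<epsilon> x)\<^sup>2)
      \<le> \<delta> * integral (cube (R + 1)) ?w + 2 * \<epsilon>\<^sup>2 * M / r ^ 4 * c" by blast
  also have "\<dots> \<le> \<delta> * C + \<eta> / 2"
    using radial_weight_integral_bound[of \<epsilon> R] \<epsilon> R \<epsilon>c \<delta>(1)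
    by (intro add_mono mult_left_mono) (auto simp: C_def c_def)
  also have "\<dots> \<le> \<eta>" using \<delta>(2) by simp
  finally show ?thesis using \<epsilon> by blast
qed

lemma nn_integral_finite_imp_integral_bounded:
  fixes f :: "real^3 \<Rightarrow> real"
  assumes f: "continuous_on UNIV f" "\<And>x. 0 \<le> f x" and fin: "(\<integral>\<^sup>+x. ennreal (f x) \<partial>lborel) < \<infinity>"
  shows "\<exists>M\<ge>0. \<forall>n. integral (cube n) f \<le> M"
proof -
  have "integrable lborel f"
    by (rule integrableI_nonneg) (use f fin in \<open>auto intro: borel_measurable_continuous_onI\<close>)
  then have int: "f integrable_on UNIV" by (rule integrable_on_lborel)
  have "integral (cube n) f \<le> integral UNIV f" for n
    by (intro integral_subset_le integrable_on_cube f(1) int) (use f in auto)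
  moreover have "0 \<le> integral UNIV f"
    by (intro integral_nonneg int f)
  ultimately show ?thesis by blast
qed

lemma C1_on_potential_compose:
  assumes "potential P" "C1_on UNIV \<phi>" "\<And>x. norm (\<phi> x) = 1"
  shows "C1_on UNIV (\<lambda>x. P (\<phi> x))"
proof -
  obtain U F where F: "S2 \<subseteq> U" "C1_on U F" "\<And>y. y \<in> S2 \<Longrightarrow> F y = P y"
    using assms(1) unfolding potential_def by blast
  have eq: "(\<lambda>x. P (\<phi> x)) = (\<lambda>x. F (\<phi> x))"
    using F assms(3) by auto
  show ?thesis
    unfolding eq by (rule C1_on_compose[OF F(2) assms(2)]) (use F(1) assms(3) in auto)
qed

section \<open>Finite energy solutions: the limits and the conclusion\<close>

locale axisymmetric_no_swirl_solution =
  fixes P :: "real^3 \<Rightarrow> real" and \<phi> :: "real^3 \<Rightarrow> real^3" and \<phi>' :: "real^3 \<Rightarrow> real^3 \<Rightarrow> real^3"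
    and k l :: int and \<Theta> \<psi> :: "real \<Rightarrow> real \<Rightarrow> real" and A :: "real \<Rightarrow> real"
  assumes potential: "potential P" and solution: "FS_solution P \<phi>" and finite_energy: "energy P \<phi> < \<infinity>"
    and deriv: "\<And>x. (\<phi> has_derivative \<phi>' x) (at x)"
    and form: "axisymmetric_form \<phi> k l \<Theta> \<psi>"
    and no_swirl: "\<And>\<rho> z. 0 \<le> \<rho> \<Longrightarrow> \<psi> \<rho> z = A (\<Theta> \<rho> z)"
begin

definition B :: "real^3 \<Rightarrow> real^3" where "B x = pullback_dual (\<phi> x) (\<phi>' x)"

text \<open>This is rho B_rho; unlike B_rho it is defined and continuous on the axis.\<close>

definition radial :: "real^3 \<Rightarrow> real" where "radial x = x$1 * B x $ 1 + x$2 * B x $ 2"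

lemma sphere: "norm (\<phi> x) = 1"
  using solution by (simp add: FS_solution_def FS_field_def)

lemma C2: "C2_on UNIV \<phi>"
  using solution by (simp add: FS_solution_def)

lemma continuous: "continuous_on UNIV \<phi>"
  by (intro C1_on_imp_continuous_on C2_on_imp_C1_on C2)

lemma continuous_on_B: "continuous_on UNIV B"
  using C1_on_imp_continuous_on[OF C1_on_pullback_dual[OF C2 deriv]] by (simp add: B_def[abs_def])

lemma continuous_on_radial: "continuous_on UNIV radial"
  unfolding radial_def by (intro continuous_intros continuous_on_B)

lemma continuous_on_potential: "continuous_on UNIV (\<lambda>x. P (\<phi> x))"
  by (intro C1_on_imp_continuous_on C1_on_potential_compose C2_on_imp_C1_on C2 potential sphere)

lemma potential_nonneg: "0 \<le> P (\<phi> x)"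
  using potential sphere by (simp add: potential_def)

lemma radial_eq: "radial x = of_int l * \<phi>' x (axis 3 1) $ 3"
  unfolding radial_def B_def using axisymmetric_radial_component[OF form deriv sphere] .

lemma angular_eq: "x$2 * B x $ 1 = x$1 * B x $ 2"
  unfolding B_def by (rule axisymmetric_angular_component[OF form no_swirl continuous sphere deriv])

lemma bounded_energy:
  obtains M where "M \<ge> 0" "\<And>n. integral (cube n) (\<lambda>x. (norm (B x))\<^sup>2 / 2 + P (\<phi> x)) \<le> M"
proof -
  have "energy_density P \<phi> x = 2 * ((norm (B x))\<^sup>2 / 2 + P (\<phi> x))" for x
    unfolding energy_density_def B_def wedge2_sq_pullback_dual[OF deriv sphere] by simp
  then have "1/2 * energy_density P \<phi> x = (norm (B x))\<^sup>2 / 2 + P (\<phi> x)" for x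
    by simp
  then have "(\<integral>\<^sup>+x. ennreal ((norm (B x))\<^sup>2 / 2 + P (\<phi> x)) \<partial>lborel) < \<infinity>"
    using finite_energy by (simp only: energy_def)
  moreover have "continuous_on UNIV (\<lambda>x. (norm (B x))\<^sup>2 / 2 + P (\<phi> x))"
    by (intro continuous_intros continuous_on_B continuous_on_potential) auto
  ultimately have "\<exists>M\<ge>0. \<forall>n. integral (cube n) (\<lambda>x. (norm (B x))\<^sup>2 / 2 + P (\<phi> x)) \<le> M"
    by (intro nn_integral_finite_imp_integral_bounded) (simp_all add: potential_nonneg)
  then show thesis using that by blast
qed

lemma stress_identity:
  assumes R: "R > 0" and \<epsilon>: "\<epsilon> \<noteq> 0"
  shows "((\<lambda>x. ((norm (B x))\<^sup>2 / 2 - P (\<phi> x)) * (2 * (cutoff R x) ^ 3 * \<epsilon>\<^sup>2 / (axis_dist \<epsilon> x)\<^sup>2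
        - 6 * (cutoff R x)\<^sup>2 * ((x$1)\<^sup>2 + (x$2)\<^sup>2) / (R\<^sup>2 * axis_dist \<epsilon> x))
      - (- 6 * (cutoff R x)\<^sup>2 * (radial x + x$3 * B x $ 3) * radial x / (R\<^sup>2 * axis_dist \<epsilon> x)
        - 2 * (cutoff R x) ^ 3 * (radial x)\<^sup>2 / (axis_dist \<epsilon> x)\<^sup>2
        + (cutoff R x) ^ 3 * ((B x $ 1)\<^sup>2 + (B x $ 2)\<^sup>2) / axis_dist \<epsilon> x)) has_integral 0) (cube (R + 1))"
  using inner_variation_identity[OF solution deriv potential C2_on_radial_field[OF \<epsilon>]
      radial_field_has_derivative[OF \<epsilon> R] radial_field_support[OF R] less_imp_le[OF R],
      of "vector [-(R+1), -(R+1), -(R+1)]" "vector [R+1, R+1, R+1]"]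
    cball_subset_cube[of "R + 1"]
  unfolding radial_field_divergence[OF \<epsilon>] B_def[symmetric] radial_field_quadratic_form[OF angular_eq]
    radial_def[symmetric] cube_def
  by blast

text \<open>The error 21 |B|^2/R^2 is at most \<open>42 / R\<^sup>2\<close> times the energy density
  |B|^2/2 + P. Clearing the factor 1/2 left by the absorption doubles it to 84.\<close>

lemma radial_estimate:
  assumes R: "R > 0" and \<epsilon>: "\<epsilon> \<noteq> 0"
    and M: "integral (cube (R + 1)) (\<lambda>x. (norm (B x))\<^sup>2 / 2 + P (\<phi> x)) \<le> M"
  shows "integral (cube (R + 1)) (\<lambda>x. (cutoff R x) ^ 3 * (radial x)\<^sup>2 / (axis_dist \<epsilon> x)\<^sup>2)
    \<le> 2 * integral (cube (R + 1)) (\<lambda>x. 2 * (cutoff R x) ^ 3 * \<epsilon>\<^sup>2 * P (\<phi> x) / (axis_dist \<epsilon> x)\<^sup>2) + 84 * M / R\<^sup>2"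
proof -
  let ?I = "integral (cube (R + 1))"
  let ?g = "\<lambda>x. (cutoff R x) ^ 3 * (radial x)\<^sup>2 / (axis_dist \<epsilon> x)\<^sup>2"
  let ?h = "\<lambda>x. 2 * (cutoff R x) ^ 3 * \<epsilon>\<^sup>2 * P (\<phi> x) / (axis_dist \<epsilon> x)\<^sup>2"
  let ?f = "\<lambda>x. (norm (B x))\<^sup>2 / 2 + P (\<phi> x)"
  have q: "axis_dist \<epsilon> x \<noteq> 0" for x using axis_dist_pos[OF \<epsilon>, of x] by simp
  have int: "?g integrable_on cube (R + 1)" "?h integrable_on cube (R + 1)" "?f integrable_on cube (R + 1)"
    using q by (auto intro!: integrable_on_cube continuous_intros continuous_on_B continuous_on_radial continuous_on_potential)
  have "((\<lambda>x. 1/2 * ?g x - ?h x - 42 / R\<^sup>2 * ?f x) has_integral 1/2 * ?I ?g - ?I ?h - 42 / R\<^sup>2 * ?I ?f) (cube (R + 1))"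
    by (intro has_integral_diff has_integral_mult_right integrable_integral int)
  from has_integral_le[OF this stress_identity[OF R \<epsilon>]]
  have "1/2 * ?I ?g - ?I ?h - 42 / R\<^sup>2 * ?I ?f \<le> 0"
  proof (elim meta_mp)
    fix x
    have z: "\<bar>x$3\<bar> \<le> R" if "cutoff R x > 0"
      using cutoff_eq_0[OF R, of x] that component_le_norm_cart[of x 3] by fastforce
    have N: "(norm (B x))\<^sup>2 = ((B x $ 1)\<^sup>2 + (B x $ 2)\<^sup>2) + (B x $ 3)\<^sup>2"
      unfolding power2_norm_eq_inner inner_vec3 by (simp add: power2_eq_square)
    have "((B x $ 1)\<^sup>2 + (B x $ 2)\<^sup>2) * ((x$1)\<^sup>2 + (x$2)\<^sup>2) =
        (x$1 * B x $ 1 + x$2 * B x $ 2)\<^sup>2 + (x$2 * B x $ 1 - x$1 * B x $ 2)\<^sup>2"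
      by (simp add: power2_eq_square algebra_simps)
    then have s: "((B x $ 1)\<^sup>2 + (B x $ 2)\<^sup>2) * ((x$1)\<^sup>2 + (x$2)\<^sup>2) = (radial x)\<^sup>2"
      using angular_eq[of x] by (simp add: radial_def)
    have qr: "axis_dist \<epsilon> x = \<epsilon>\<^sup>2 + ((x$1)\<^sup>2 + (x$2)\<^sup>2)" "0 < \<epsilon>\<^sup>2" "0 \<le> (x$1)\<^sup>2 + (x$2)\<^sup>2"
      using \<epsilon> by (simp_all add: axis_dist_def)
    have "42 / R\<^sup>2 * ?f x \<ge> 21 * (norm (B x))\<^sup>2 / R\<^sup>2"
      using potential_nonneg[of x] by (simp add: divide_right_mono distrib_left)
    moreover note stress_lower_bound[of "\<epsilon>\<^sup>2" "(x$1)\<^sup>2 + (x$2)\<^sup>2" "cutoff R x" R "P (\<phi> x)" "x$3"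
        "(B x $ 1)\<^sup>2 + (B x $ 2)\<^sup>2" "radial x" "B x $ 3", OF qr(2,3) cutoff_bounds R potential_nonneg z s,
        folded N qr(1)]
    moreover have "1/2 * ?g x = (cutoff R x) ^ 3 * (radial x)\<^sup>2 / (2 * (axis_dist \<epsilon> x)\<^sup>2)"
      by simp
    ultimately show "1/2 * ?g x - ?h x - 42 / R\<^sup>2 * ?f x \<le>
      ((norm (B x))\<^sup>2 / 2 - P (\<phi> x)) * (2 * (cutoff R x) ^ 3 * \<epsilon>\<^sup>2 / (axis_dist \<epsilon> x)\<^sup>2
        - 6 * (cutoff R x)\<^sup>2 * ((x$1)\<^sup>2 + (x$2)\<^sup>2) / (R\<^sup>2 * axis_dist \<epsilon> x))
      - (- 6 * (cutoff R x)\<^sup>2 * (radial x + x$3 * B x $ 3) * radial x / (R\<^sup>2 * axis_dist \<epsilon> x)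
        - 2 * (cutoff R x) ^ 3 * (radial x)\<^sup>2 / (axis_dist \<epsilon> x)\<^sup>2
        + (cutoff R x) ^ 3 * ((B x $ 1)\<^sup>2 + (B x $ 2)\<^sup>2) / axis_dist \<epsilon> x)"
      using zero_le_power2[of "B x $ 1"] zero_le_power2[of "B x $ 2"] by linarith
  qed
  moreover have "42 / R\<^sup>2 * ?I ?f \<le> 42 / R\<^sup>2 * M"
    using M by (intro mult_left_mono) auto
  ultimately show ?thesis by simp
qed

lemma radial_zero:
  assumes axis: "\<And>x. x$1 = 0 \<Longrightarrow> x$2 = 0 \<Longrightarrow> P (\<phi> x) = 0"
  shows "radial x = 0"
proof -
  obtain M where M: "M \<ge> 0" "\<And>n. integral (cube n) (\<lambda>x. (norm (B x))\<^sup>2 / 2 + P (\<phi> x)) \<le> M"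
    using bounded_energy by blast
  have "(radial x)\<^sup>2 = 0"
  proof (rule weighted_integral_vanishing)
    fix \<eta> R0 :: real
    assume \<eta>: "0 < \<eta>"
    \<comment> \<open>As \<open>R \<ge> 1\<close>, also
      \<open>R\<^sup>2 \<ge> 168 * M / \<eta>\<close>, which makes the error
      \<open>84 * M / R\<^sup>2\<close> at most half of \<open>\<eta>\<close>.\<close>
    define R where "R = max R0 (max 1 (168 * M / \<eta>))"
    have R: "R0 \<le> R" "1 \<le> R" "168 * M / \<eta> \<le> R" by (auto simp: R_def)
    have "168 * M / \<eta> \<le> R\<^sup>2" using R(2,3) by (smt (verit) self_le_power zero_less_numeral)
    then have "168 * M \<le> R\<^sup>2 * \<eta>" using \<eta> by (simp add: field_simps)
    then have MR: "84 * M / R\<^sup>2 \<le> \<eta> / 2" using R(2) by (simp add: field_simps)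
    \<comment> \<open>Chosen after \<open>R\<close>. The quarter of \<open>\<eta>\<close> is doubled
      in \<open>radial_estimate\<close>.\<close>
    obtain \<epsilon> where \<epsilon>: "0 < \<epsilon>" "\<epsilon> \<le> 1"
      "integral (cube (R + 1)) (\<lambda>x. 2 * (cutoff R x) ^ 3 * \<epsilon>\<^sup>2 * P (\<phi> x) / (axis_dist \<epsilon> x)\<^sup>2) \<le> \<eta> / 4"
      using axis_concentration[OF continuous_on_potential potential_nonneg axis, of R "\<eta> / 4"] R(2) \<eta>
      by auto
    have "integral (cube (R + 1)) (\<lambda>x. (cutoff R x) ^ 3 * (radial x)\<^sup>2 / (axis_dist \<epsilon> x)\<^sup>2) \<le> \<eta>"
      using radial_estimate[of R \<epsilon> M] R(2) \<epsilon> M(2)[of "R + 1"] MR by simp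
    then show "\<exists>R \<epsilon>. R0 \<le> R \<and> 0 < \<epsilon> \<and> \<epsilon> \<le> 1 \<and>
      integral (cube (R + 1)) (\<lambda>x. (cutoff R x) ^ 3 * (radial x)\<^sup>2 / (axis_dist \<epsilon> x)\<^sup>2) \<le> \<eta>"
      using R(1) \<epsilon> by blast
  qed (auto intro!: continuous_intros continuous_on_radial)
  then show ?thesis by simp
qed

text \<open>For \<open>l = 0\<close> the derivative kills the angular direction, so B could only be
  angular, and the absence of swirls excludes that. The plane \<open>x$1 = 0\<close> is left out
  instead of the axis alone because a hyperplane is readily negligible.\<close>

lemma B_zero_off_axis:
  assumes "l = 0" "x$1 \<noteq> 0"
  shows "B x = 0"
proof -
  have r: "(x$1)\<^sup>2 + (x$2)\<^sup>2 \<noteq> 0"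
    using assms(2) by (simp add: sum_power2_eq_zero_iff)
  have "x$1 * B x $ 1 + x$2 * B x $ 2 = 0"
    using radial_eq[of x] assms(1) by (simp add: radial_def)
  moreover have "(B x $ 1) * ((x$1)\<^sup>2 + (x$2)\<^sup>2) = x$1 * (x$1 * B x $ 1 + x$2 * B x $ 2) + x$2 * (x$2 * B x $ 1 - x$1 * B x $ 2)"
    "(B x $ 2) * ((x$1)\<^sup>2 + (x$2)\<^sup>2) = x$2 * (x$1 * B x $ 1 + x$2 * B x $ 2) - x$1 * (x$2 * B x $ 1 - x$1 * B x $ 2)"
    by (simp_all add: power2_eq_square algebra_simps)
  ultimately have B12: "B x $ 1 = 0" "B x $ 2 = 0"
    using angular_eq[of x] r by auto
  have "B x \<bullet> cross3 (vector [- x$2, x$1, 0]) (vector [x$1, x$2, 0]) = 0"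
    unfolding B_def pullback_dual_cross[OF has_derivative_linear[OF deriv]]
      axisymmetric_rotation_derivative[OF form deriv] using assms(1) by simp
  then have "B x $ 3 * ((x$1)\<^sup>2 + (x$2)\<^sup>2) = 0"
    using B12 by (simp add: inner_vec3 cross_components power2_eq_square algebra_simps)
  then have "B x $ 3 = 0" using r by auto
  then show ?thesis
    using B12 by (simp add: vec_eq_iff forall_3)
qed

lemma potential_zero:
  assumes "l = 0"
  shows "P (\<phi> x) = 0"
proof -
  obtain M where M: "M \<ge> 0" "\<And>n. integral (cube n) (\<lambda>x. (norm (B x))\<^sup>2 / 2 + P (\<phi> x)) \<le> M"
    using bounded_energy by blast
  show ?thesis
  proof (rule weighted_integral_vanishing[where h = "\<lambda>x. P (\<phi> x)"])
    fix \<eta> R0 :: real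
    assume \<eta>: "0 < \<eta>"
    define R where "R = max R0 (max 1 (3 * M / \<eta>))"
    have R: "R0 \<le> R" "1 \<le> R" "3 * M / \<eta> \<le> R" by (auto simp: R_def)
    have "3 * M / \<eta> \<le> R\<^sup>2" using R(2,3) by (smt (verit) self_le_power zero_less_numeral)
    then have "3 * M \<le> R\<^sup>2 * \<eta>" using \<eta> by (simp add: field_simps)
    then have MR: "3 * M / R\<^sup>2 \<le> \<eta>" using R(2) by (simp add: field_simps)
    let ?I = "integral (cube (R + 1))"
    let ?g = "\<lambda>x. (cutoff R x) ^ 3 * P (\<phi> x) / (axis_dist 1 x)\<^sup>2"
    let ?f = "\<lambda>x. (norm (B x))\<^sup>2 / 2 + P (\<phi> x)"
    have q: "axis_dist 1 x > 0" for x using axis_dist_pos[of 1 x] by simp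
    have int: "?g integrable_on cube (R + 1)" "?f integrable_on cube (R + 1)"
      using q by (auto intro!: integrable_on_cube continuous_intros continuous_on_B continuous_on_potential simp: less_imp_neq[symmetric])
    have "R > 0" using R(2) by simp
    have upper: "((\<lambda>x. 6 / R\<^sup>2 * ?f x - 2 * ?g x) has_integral 6 / R\<^sup>2 * ?I ?f - 2 * ?I ?g) (cube (R + 1))"
      by (intro has_integral_diff has_integral_mult_right integrable_integral int)
    have plane: "negligible {x::real^3. x$1 = 0}"
      using negligible_standard_hyperplane[of "axis 1 1 :: real^3" 0] by (simp add: inner_axis axis_in_Basis_iff)
    have "0 \<le> 6 / R\<^sup>2 * ?I ?f - 2 * ?I ?g"
    proof (rule has_integral_le_off_negligible[OF stress_identity[OF \<open>R > 0\<close> one_neq_zero] upper plane])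
      fix x :: "real^3"
      assume "x \<notin> {x. x$1 = 0}"
      then have Bx: "B x = 0" using B_zero_off_axis[OF assms] by simp
      define r where "r = (x$1)\<^sup>2 + (x$2)\<^sup>2"
      have "(cutoff R x)\<^sup>2 * (r / axis_dist 1 x) \<le> 1 * 1"
        using cutoff_bounds[of R x] q[of x]
        by (intro mult_mono) (auto simp: axis_dist_def r_def power_le_one divide_simps)
      then have "6 / R\<^sup>2 * P (\<phi> x) * ((cutoff R x)\<^sup>2 * (r / axis_dist 1 x)) \<le> 6 / R\<^sup>2 * P (\<phi> x) * 1"
        using potential_nonneg[of x] by (intro mult_left_mono) auto
      then show "((norm (B x))\<^sup>2 / 2 - P (\<phi> x)) * (2 * (cutoff R x) ^ 3 * 1\<^sup>2 / (axis_dist 1 x)\<^sup>2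
        - 6 * (cutoff R x)\<^sup>2 * ((x$1)\<^sup>2 + (x$2)\<^sup>2) / (R\<^sup>2 * axis_dist 1 x))
      - (- 6 * (cutoff R x)\<^sup>2 * (radial x + x$3 * B x $ 3) * radial x / (R\<^sup>2 * axis_dist 1 x)
        - 2 * (cutoff R x) ^ 3 * (radial x)\<^sup>2 / (axis_dist 1 x)\<^sup>2
        + (cutoff R x) ^ 3 * ((B x $ 1)\<^sup>2 + (B x $ 2)\<^sup>2) / axis_dist 1 x) \<le> 6 / R\<^sup>2 * ?f x - 2 * ?g x"
        unfolding r_def[symmetric] by (simp add: Bx radial_def right_diff_distrib mult_ac)
    qed
    moreover have "6 / R\<^sup>2 * ?I ?f \<le> 6 / R\<^sup>2 * M"
      using M(2) by (intro mult_left_mono) auto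
    ultimately have "?I ?g \<le> \<eta>" using MR by simp
    then show "\<exists>R \<epsilon>. R0 \<le> R \<and> 0 < \<epsilon> \<and> \<epsilon> \<le> 1 \<and>
      integral (cube (R + 1)) (\<lambda>x. (cutoff R x) ^ 3 * P (\<phi> x) / (axis_dist \<epsilon> x)\<^sup>2) \<le> \<eta>"
      using R(1) by (intro exI[of _ R] exI[of _ 1]) auto
  qed (auto intro!: continuous_on_potential potential_nonneg)
qed

lemma height_near_infinity:
  assumes "e > 0"
  obtains b where "\<And>x. norm x \<ge> b \<Longrightarrow> \<bar>\<phi> x $ 3 - 1\<bar> < e"
proof -
  have lim: "(\<phi> \<longlongrightarrow> vector [0, 0, 1]) at_infinity"
    using solution by (simp add: FS_solution_def FS_field_def)
  have "((\<lambda>x. \<phi> x $ 3) \<longlongrightarrow> (vector [0, 0, 1] :: real^3) $ 3) at_infinity"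
    by (intro tendsto_vec_nth lim)
  then have "\<forall>\<^sub>F x in at_infinity. dist (\<phi> x $ 3) 1 < e"
    using assms by (simp add: tendsto_iff)
  then show thesis
    using that by (auto simp: eventually_at_infinity dist_norm)
qed

text \<open>The height is constant along the vertical line through \<open>x\<close> and tends to 1
  at its end. The hypothesis concerns this one line so that the lemma applies to the axis alone as
  well.\<close>

lemma height_eq_1_vertical:
  assumes "\<And>t. \<phi>' (x + t *\<^sub>R axis 3 1) (axis 3 1) $ 3 = 0"
  shows "\<phi> x $ 3 = 1"
proof (rule ccontr)
  assume "\<phi> x $ 3 \<noteq> 1"
  then obtain b where b: "\<And>y. norm y \<ge> b \<Longrightarrow> \<bar>\<phi> y $ 3 - 1\<bar> < \<bar>\<phi> x $ 3 - 1\<bar>"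
    using height_near_infinity[of "\<bar>\<phi> x $ 3 - 1\<bar>"] by auto
  define g where "g t = \<phi> (x + t *\<^sub>R axis 3 1) $ 3" for t
  have "(g has_real_derivative 0) (at t)" for t
  proof -
    have "((\<lambda>s. \<phi> (x + s *\<^sub>R axis 3 1) $ 3) has_derivative (\<lambda>s. \<phi>' (x + t *\<^sub>R axis 3 1) (s *\<^sub>R axis 3 1) $ 3)) (at t)"
      by (intro bounded_linear.has_derivative[OF bounded_linear_vec_nth] has_derivative_compose[OF _ deriv])
        (auto intro!: derivative_eq_intros)
    then show ?thesis
      unfolding g_def has_field_derivative_def
      by (simp add: linear_scale[OF has_derivative_linear[OF deriv]] assms mult_zero_left[abs_def])
  qed
  then have const: "g t = g 0" for t
    using DERIV_const_ratio_const2 by (metis DERIV_isconst_all)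
  \<comment> \<open>Far enough up the line that the reverse triangle inequality gives norm at least
    \<open>b\<close>.\<close>
  define t where "t = \<bar>b\<bar> + norm x"
  have "norm (x + t *\<^sub>R axis 3 1) \<ge> b"
    using norm_triangle_ineq2[of "t *\<^sub>R axis 3 1 :: real^3" "- x"] by (simp add: t_def add.commute)
  from b[OF this] const[of t] show False by (simp add: g_def)
qed

lemma constant_if_height_eq_1:
  assumes "\<And>x. \<phi> x $ 3 = 1"
  shows "\<phi> constant_on UNIV"
proof -
  have "\<phi> x = vector [0, 0, 1]" for x
  proof -
    have "(\<phi> x $ 1)\<^sup>2 + (\<phi> x $ 2)\<^sup>2 = 0"
      using sphere[of x] assms[of x] by (simp add: norm_eq_1 inner_vec3 power2_eq_square)
    then show ?thesis
      using assms[of x] by (simp add: sum_power2_eq_zero_iff vec_eq_iff forall_3)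
  qed
  then show ?thesis by (auto simp: constant_on_def)
qed

text \<open>Nothing is asked of P at negative heights, where the power form is silent for a general
  exponent. For \<open>l = 0\<close> continuity bridges this: a field starting at negative height
  would have to cross the heights between 0 and 1 before reaching the north pole. For
  \<open>l \<noteq> 0\<close> the vertical argument runs twice: on the axis, where rho B_rho is
  trivially 0, to get P = 0 there, and then everywhere.\<close>

lemma field_constant:
  assumes north: "\<And>y. y \<in> S2 \<Longrightarrow> y$3 = 1 \<Longrightarrow> P y = 0"
    and upper: "\<And>y. y \<in> S2 \<Longrightarrow> 0 \<le> y$3 \<Longrightarrow> y$3 < 1 \<Longrightarrow> P y \<noteq> 0"
  shows "\<phi> constant_on UNIV"
proof (rule constant_if_height_eq_1)
  fix x
  show "\<phi> x $ 3 = 1"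
  proof (cases "l = 0")
    case False
    have "P (\<phi> y) = 0" if y: "y$1 = 0" "y$2 = 0" for y
    proof -
      have "radial (y + t *\<^sub>R axis 3 1) = 0" for t
        using y by (simp add: radial_def axis_def)
      then have "\<phi> y $ 3 = 1"
        using False by (intro height_eq_1_vertical) (simp add: radial_eq)
      then show ?thesis using north sphere by simp
    qed
    then have "radial y = 0" for y by (rule radial_zero)
    then show ?thesis
      using False by (intro height_eq_1_vertical) (simp add: radial_eq)
  next
    case True
    \<comment> \<open>P vanishes along the whole field, so its height avoids the interval from 0 up
      to but excluding 1; the value 1/4 used below is any point of it.\<close>
    have gap: "\<phi> y $ 3 < 0 \<or> 1 \<le> \<phi> y $ 3" for y
      using upper[of "\<phi> y"] potential_zero[OF True, of y] sphere[of y] by force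
    have "1 \<le> \<phi> x $ 3"
    proof (rule ccontr)
      assume "\<not> 1 \<le> \<phi> x $ 3"
      then have neg: "\<phi> x $ 3 < 0" using gap by blast
      obtain b where b: "\<And>y. norm y \<ge> b \<Longrightarrow> \<bar>\<phi> y $ 3 - 1\<bar> < 1/2"
        using height_near_infinity[of "1/2"] by auto
      have "\<bar>\<phi> (b *\<^sub>R axis 1 1) $ 3 - 1\<bar> < 1/2" by (rule b) simp
      then have pos: "1/2 \<le> \<phi> (b *\<^sub>R axis 1 1) $ 3" by linarith
      have "connected ((\<lambda>y. \<phi> y $ 3) ` UNIV)"
        by (intro connected_continuous_image continuous_intros continuous) auto
      then have "1/4 \<in> (\<lambda>y. \<phi> y $ 3) ` UNIV"
        using neg pos connectedD_interval[of "(\<lambda>y. \<phi> y $ 3) ` UNIV" "\<phi> x $ 3" "\<phi> (b *\<^sub>R axis 1 1) $ 3" "1/4"]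
        by auto
      then obtain y where "\<phi> y $ 3 = 1/4" by auto
      then show False using gap[of y] by simp
    qed
    moreover have "\<phi> x $ 3 \<le> 1"
      using component_le_norm_cart[of "\<phi> x" 3] sphere[of x] by simp
    ultimately show ?thesis by simp
  qed
qed

end

lemma power_form_zeros:
  assumes "a > 0" "b > 0" "power_form a b P" "y \<in> S2" "0 \<le> y$3"
  shows "P y = 0 \<longleftrightarrow> y$3 = 1"
proof -
  have P: "P y = (1 - (y$3) powr a) powr b"
    using assms(3-5) by (simp add: power_form_def)
  have "(y$3) powr a = 1 \<longleftrightarrow> y$3 = 1"
    using assms(1,5) by (cases "y$3 = 0") (auto simp: powr_def)
  then show ?thesis
    unfolding P using assms(2) by auto
qed

text \<open>Constant fields are set apart because the constant map to the north pole is a solution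
  of zero energy.\<close>

theorem proposition4:
  fixes a b :: real and P :: "real^3 \<Rightarrow> real"
  assumes "a > 0" and "b > 0"
    and "potential P" and "power_form a b P"
  shows "\<not> (\<exists>\<phi> :: real^3 \<Rightarrow> real^3.
            FS_solution P \<phi> \<and> energy P \<phi> < \<infinity> \<and> axisymmetric_no_swirl \<phi> \<and>
            \<not> \<phi> constant_on UNIV)"
proof (intro notI, elim exE conjE)
  fix \<phi> :: "real^3 \<Rightarrow> real^3"
  assume \<phi>: "FS_solution P \<phi>" "energy P \<phi> < \<infinity>" "axisymmetric_no_swirl \<phi>" "\<not> \<phi> constant_on UNIV"
  obtain k l \<Theta> \<psi> A where form: "axisymmetric_form \<phi> k l \<Theta> \<psi>"
    "\<And>\<rho> z. 0 \<le> \<rho> \<Longrightarrow> \<psi> \<rho> z = A (\<Theta> \<rho> z)"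
    using \<phi>(3) unfolding axisymmetric_no_swirl_def by metis
  have "C1_on UNIV \<phi>"
    using \<phi>(1) by (simp add: FS_solution_def C2_on_imp_C1_on)
  then obtain \<phi>' where "\<And>x. (\<phi> has_derivative \<phi>' x) (at x)"
    using C1_on_UNIV_derivative by blast
  then interpret axisymmetric_no_swirl_solution P \<phi> \<phi>' k l \<Theta> \<psi> A
    using assms(3) \<phi>(1,2) form by unfold_locales auto
  have "\<phi> constant_on UNIV"
    by (rule field_constant) (use power_form_zeros[OF assms(1,2,4)] in auto)
  with \<phi>(4) show False by contradiction
qed

end
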